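(* Let $n\ge 1$ and let $A\in\mathcal{M}_n(\mathbb{T})$ be an $n\times n$ tropical matrix. Then for every integer $t\ge (n-1)^2+1$, $$\operatorname{rk}_{\mathrm{fc}}(A^{t})\le \operatorname{rk}_{\mathrm{tr}}(A),$$ where $\operatorname{rk}_{\mathrm{fc}}$ denotes the factor rank and $\operatorname{rk}_{\mathrm{tr}}$ the tropical rank.
   Context: $\mathbb{T}=\mathbb{R}\cup\{-\infty\}$ is the max-plus (tropical) semiring: addition is $\max$, multiplication is the usual $+$, the zero element is $-\infty$. $\mathcal{M}_n(\mathbb{T})$ is the monoid of all $n\times n$ matrices over $\mathbb{T}$ with the induced (max-plus) multiplication, and powers $A^t$ are taken in it; $\mathcal{M}_{m,k}(\mathbb{T})$ is the set of $m\times k$ tropical matrices. For a square $k\times k$ tropical matrix $A$, the weight of a permutation $\pi\in S_k$ is $\sum_i A_{i,\pi(i)}$ and the permanent $\operatorname{per}(A)$ is the maximum of the weights of all $\pi\in S_k$. $A$ is nonsingular if there is a unique permutation whose weight equals $\operatorname{per}(A)$, and singular otherwise. The tropical rank $\operatorname{rk}_{\mathrm{tr}}(A)$ of a tropical matrix $A$ is the largest $k$ for which $A$ has a $k\times k$ nonsingular submatrix. The factor rank $\operatorname{rk}_{\mathrm{fc}}(A)$ of an $n\times n$ tropical matrix $A$ is the smallest $k$ for which $A=BC$ (max-plus product) with $B\in\mathcal{M}_{n,k}(\mathbb{T})$ and $C\in\mathcal{M}_{k,n}(\mathbb{T})$; equivalently, the minimal number of rank-one matrices whose entrywise maximum is $A$.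 *)

theory Defs
  imports
    Complex_Main
    "HOL-Combinatorics.Permutations"
    "Jordan_Normal_Form.Matrix"
    "Jordan_Normal_Form.DL_Submatrix"
begin

datatype trop = NegInf | Fin real

instantiation trop :: linorder
begin

fun less_eq_trop :: "trop \<Rightarrow> trop \<Rightarrow> bool" where
  "NegInf \<le> y \<longleftrightarrow> True"
| "Fin a \<le> NegInf \<longleftrightarrow> False"
| "Fin a \<le> Fin b \<longleftrightarrow> a \<le> b"

definition less_trop :: "trop \<Rightarrow> trop \<Rightarrow> bool" where
  "x < y \<longleftrightarrow> x \<le> y \<and> \<not> y \<le> (x :: trop)"

instance
proof
  fix x y z :: trop
  show "x < y \<longleftrightarrow> x \<le> y \<and> \<not> y \<le> x" by (rule less_trop_def)
  show "x \<le> x" by (cases x) auto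
  show "x \<le> z" if "x \<le> y" "y \<le> z"
    using that by (cases x; cases y; cases z; simp)
  show "x = y" if "x \<le> y" "y \<le> x"
    using that by (cases x; cases y; simp)
  show "x \<le> y \<or> y \<le> x" by (cases x; cases y) auto
qed

end

text \<open>The semiring operations are the max-plus ones: from here on, on type \<open>trop\<close>,
  \<open>x + y\<close> is the maximum, \<open>x * y\<close> is the usual sum, \<open>0\<close> is minus infinity and \<open>1\<close> is
  the real number zero. The library's matrix product and matrix powers over \<open>trop\<close>
  are therefore the max-plus ones, and \<open>\<Sum>\<close>, \<open>\<Prod>\<close> denote maximum and usual sum.\<close>

instantiation trop :: comm_semiring_1
begin

definition zero_trop :: trop where "0 = NegInf"

definition one_trop :: trop where "1 = Fin 0"

definition plus_trop :: "trop \<Rightarrow> trop \<Rightarrow> trop" where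
  "x + y = max x (y :: trop)"

fun times_trop :: "trop \<Rightarrow> trop \<Rightarrow> trop" where
  "NegInf * y = NegInf"
| "Fin a * NegInf = NegInf"
| "Fin a * Fin b = Fin (a + b)"

instance
proof
  fix a b c :: trop
  show "a * b * c = a * (b * c)" by (cases a; cases b; cases c) auto
  show "a * b = b * a" by (cases a; cases b) auto
  show "1 * a = a" by (cases a) (auto simp: one_trop_def)
  show "a + b + c = a + (b + c)" by (simp add: plus_trop_def max.assoc)
  show "a + b = b + a" by (simp add: plus_trop_def max.commute)
  show "0 + a = a" by (simp add: plus_trop_def zero_trop_def max_def)
  show "0 * a = 0" by (simp add: zero_trop_def)
  show "a * 0 = 0" by (cases a) (auto simp: zero_trop_def)
  show "(a + b) * c = a * c + b * c"
    by (cases a; cases b; cases c) (auto simp: plus_trop_def max_def)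
  show "(0 :: trop) \<noteq> 1" by (simp add: zero_trop_def one_trop_def)
qed

end

definition trop_weight :: "trop mat \<Rightarrow> (nat \<Rightarrow> nat) \<Rightarrow> trop" where
  "trop_weight A \<pi> = (\<Prod>i<dim_row A. A $$ (i, \<pi> i))"

definition trop_per :: "trop mat \<Rightarrow> trop" where
  "trop_per A = Max (trop_weight A ` {\<pi>. \<pi> permutes {..<dim_row A}})"

text \<open>The permanent is allowed to be minus infinity here. For matrices of size at least
  two an infinite permanent is attained by every permutation, so such matrices are
  singular; a matrix of size one is always nonsingular.\<close>

definition trop_nonsingular :: "trop mat \<Rightarrow> bool" where
  "trop_nonsingular A \<longleftrightarrow> square_mat A \<and>
     (\<exists>!\<pi>. \<pi> permutes {..<dim_row A} \<and> trop_weight A \<pi> = trop_per A)"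

definition tropical_rank :: "trop mat \<Rightarrow> nat" where
  "tropical_rank A = Max {k. \<exists>I J. I \<subseteq> {..<dim_row A} \<and> J \<subseteq> {..<dim_col A} \<and>
     card I = k \<and> card J = k \<and> trop_nonsingular (submatrix A I J)}"

text \<open>Inner dimension zero is permitted: the product of an \<open>n \<times> 0\<close> and a \<open>0 \<times> n\<close>
  matrix is the matrix with all entries minus infinity (an empty maximum), which
  thus has factor rank zero.\<close>

definition factor_rank :: "trop mat \<Rightarrow> nat" where
  "factor_rank A = (LEAST k. \<exists>B C. B \<in> carrier_mat (dim_row A) k \<and>
     C \<in> carrier_mat k (dim_col A) \<and> A = B * C)"

text \<open>The maximum in \<open>tropical_rank\<close> is over a finite nonempty set, and the minimum in
  \<open>factor_rank\<close> is attained.\<close>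

lemma finite_tropical_rank_set:
  "finite {k. \<exists>I J. I \<subseteq> {..<dim_row A} \<and> J \<subseteq> {..<dim_col A} \<and>
     card I = k \<and> card J = k \<and> trop_nonsingular (submatrix A I J)}"
proof (rule finite_subset)
  show "finite {..dim_row A}" by simp
qed (auto dest!: card_mono[rotated])

lemma tropical_rank_set_nonempty:
  "0 \<in> {k. \<exists>I J. I \<subseteq> {..<dim_row A} \<and> J \<subseteq> {..<dim_col A} \<and>
     card I = k \<and> card J = k \<and> trop_nonsingular (submatrix A I J)}"
proof -
  have "trop_nonsingular (submatrix A {} {})"
    by (auto simp: trop_nonsingular_def trop_per_def trop_weight_def dim_submatrix)
  then show ?thesis by (intro CollectI exI[of _ "{}"]) auto
qed

lemma factor_rank_attained:
  "\<exists>B C. B \<in> carrier_mat (dim_row A) (factor_rank A) \<and>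
     C \<in> carrier_mat (factor_rank A) (dim_col A) \<and> A = B * C"
  unfolding factor_rank_def
proof (rule LeastI)
  show "\<exists>B C. B \<in> carrier_mat (dim_row A) (dim_col A) \<and>
     C \<in> carrier_mat (dim_col A) (dim_col A) \<and> A = B * C"
    by (intro exI[of _ A] exI[of _ "1\<^sub>m (dim_col A)"]) auto
qed

end

theory Submission
  imports Defs "HOL-Library.Sublist"
begin

text \<open>
  View the matrix as a weighted digraph, so that entries of powers are maximal walk weights.
  Starting from all vertices, repeatedly take a shortest cycle \<open>Z\<close> of maximal mean \<open>l\<close> and delete its
  vertices, until the rest is acyclic. A walk of length \<open>t\<close> is classified by the first of these
  cycles that it meets, say \<open>Z\<close> of length \<open>d\<close>: inserting turns of \<open>Z\<close>, and removing cycles of total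
  length divisible by \<open>d\<close>, shows that the walks of this class contribute a product through \<open>d\<close> vertices,
  as soon as \<open>t\<close> is at least the Wielandt number. Hence the factor rank is at most the total length of the
  cycles.

  Not all of these cycles are needed. Put \<open>\<mu> u = l\<close> on \<open>Z\<close>. The cycle \<open>Z\<close> is kept only if, on the set \<open>U\<close> of
  vertices kept so far together with \<open>Z\<close>, every closed walk has weight at most its sum of \<open>\<mu>\<close>,
  with equality only along the selected cycles. Otherwise some cycle \<open>c\<close> meets both \<open>Z\<close> and a kept
  cycle, and detours along \<open>c\<close> move every long walk through \<open>Z\<close> to that kept cycle without loss of
  weight. At the end the permutation formed by the kept cycles is the unique optimal one
  on \<open>U\<close>, so \<open>card U\<close> is at most the tropical rank.
\<close>

section \<open>Blocks of divisible sum and the arithmetic of the length bounds\<close>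

text \<open>Of the \<open>d + 1\<close> prefix sums with indices from 0 to \<open>d\<close> two
  agree modulo \<open>d\<close>; \<open>q\<close> is the block between them. Its entries will be
  lengths of removable cycles.\<close>

lemma sum_list_block_dvd:
  fixes ls :: "nat list"
  assumes "d > 0" "d \<le> length ls"
  shows "\<exists>p q r. ls = p @ q @ r \<and> q \<noteq> [] \<and> d dvd sum_list q"
proof -
  let ?f = "\<lambda>i. sum_list (take i ls) mod d"
  have "\<not> inj_on ?f {..d}"
  proof
    assume "inj_on ?f {..d}"
    then have "card {..d} \<le> card {..<d}"
      by (rule card_inj_on_le) (use assms in auto)
    then show False by simp
  qed
  then obtain i k where ik: "i < k" "k \<le> d" "?f i = ?f k"
    unfolding inj_on_def by (metis atMost_iff nat_neq_iff)
  let ?q = "take (k - i) (drop i ls)"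
  have k: "take k ls = take i ls @ ?q"
    using ik by (metis le_add_diff_inverse less_imp_le take_add)
  then have "sum_list (take k ls) = sum_list (take i ls) + sum_list ?q" by simp
  then have "d dvd sum_list ?q"
    using ik(3) by (metis add_diff_cancel_left' le_add1 mod_eq_dvd_iff_nat)
  moreover have "ls = take i ls @ ?q @ drop k ls"
    using k by (metis append.assoc append_take_drop_id)
  moreover have "?q \<noteq> []" using ik assms by simp
  ultimately show ?thesis by blast
qed

text \<open>The Wielandt number enters here: with \<open>d\<close> the length of a critical cycle in
  a set of \<open>k\<close> vertices, the walks left by \<open>via_reduce\<close> become shorter
  than \<open>t + d\<close>. For \<open>k = n\<close>, \<open>d = n - 1\<close> and the least
  \<open>t\<close> it is an equality.\<close>

lemma level_length_bound:
  fixes d k n t :: nat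
  assumes "d \<le> k" "k \<le> n" "d < n" "0 < d" "(n - 1)\<^sup>2 + 1 \<le> t"
  shows "d * k + k \<le> t + 2 * d"
proof -
  \<comment> \<open>Integers, because the subtractions would be truncated on
    \<open>nat\<close>.\<close>
  define D K N where "D = int d" and "K = int k" and "N = int n"
  have h: "1 \<le> D" "D \<le> K" "K \<le> N" "D \<le> N - 1" unfolding D_def K_def N_def using assms by auto
  have "int ((n - 1)\<^sup>2 + 1) = (N - 1)\<^sup>2 + 1" unfolding N_def using assms by (simp add: of_nat_diff)
  then have t: "(N - 1)\<^sup>2 + 1 \<le> int t" using assms(5) by linarith
  have "D * K + K - 2 * D \<le> (N - 1)\<^sup>2 + 1"
  proof (cases "K = N")
    case True
    then have "D * (K - 2) \<le> (N - 1) * (K - 2)" using h by (intro mult_right_mono) auto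
    then show ?thesis using True by (simp add: algebra_simps power2_eq_square)
  next
    case False
    then have k: "K \<le> N - 1" using h by simp
    have "(D - 1) * (K - 1) \<le> (N - 2) * (N - 2)" using h k by (intro mult_mono) auto
    moreover have "D * K + K - 2 * D = (D - 1) * (K - 1) + 2 * K - D - 1" by (simp add: algebra_simps)
    moreover have "(N - 1)\<^sup>2 + 1 = (N - 2) * (N - 2) + 2 * N - 2" by (simp add: algebra_simps power2_eq_square)
    ultimately show ?thesis using h k by linarith
  qed
  then have "int (d * k + k) \<le> int (t + 2 * d)" using t unfolding D_def K_def by simp
  then show ?thesis by (simp only: of_nat_le_iff)
qed

text \<open>The reason is the identity \<open>(D + B - 1)^2 - (D - 1)^2 - (B - 1) * (B - 2) = 2 * D
  * B + B - 2\<close>. It is applied with \<open>b\<close> the number of vertices off a critical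
  cycle of length \<open>d\<close>.\<close>

lemma two_level_length_bound:
  fixes d b n t :: nat
  assumes "d + b \<le> n" "0 < d" "0 < b" "(n - 1)\<^sup>2 + 1 \<le> t"
  shows "2 * d * b + b \<le> t + 1"
proof -
  define D B N where "D = int d" and "B = int b" and "N = int n"
  have h: "1 \<le> D" "1 \<le> B" "D + B \<le> N" unfolding D_def B_def N_def using assms by auto
  have "int ((n - 1)\<^sup>2 + 1) = (N - 1)\<^sup>2 + 1" unfolding N_def using assms by (simp add: of_nat_diff)
  then have t: "(N - 1)\<^sup>2 + 1 \<le> int t" using assms(4) by linarith
  have "(D + B - 1)\<^sup>2 \<le> (N - 1)\<^sup>2" using h by (intro power_mono) auto
  moreover have "0 \<le> (D - 1)\<^sup>2" by simp
  moreover have "0 \<le> (B - 1) * (B - 2)" using h by (cases "B = 1") auto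
  ultimately have "2 * D * B + B \<le> (N - 1)\<^sup>2 + 2" by (simp add: algebra_simps power2_eq_square)
  then have "int (2 * d * b + b) \<le> int (t + 1)" using t unfolding D_def B_def by simp
  then show ?thesis by (simp only: of_nat_le_iff)
qed

section \<open>Walks and removal of cycles\<close>

primrec src :: "'v list \<Rightarrow> 'v \<Rightarrow> 'v" where
  "src [] j = j"
| "src (x # xs) j = x"

lemma src_append [simp]: "src (xs @ ys) j = src xs (src ys j)"
  by (cases xs) auto

lemma src_hd: "xs \<noteq> [] \<Longrightarrow> src xs j = hd xs"
  by (cases xs) auto

text \<open>A walk is a pair of the list of its vertices without the last one, and the last one;
  thus its length is the length of the list, and concatenation is list append.\<close>

locale weighted_digraph =
  fixes E :: "'v \<Rightarrow> 'v \<Rightarrow> bool" and a :: "'v \<Rightarrow> 'v \<Rightarrow> real"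
begin

primrec wt :: "'v list \<Rightarrow> 'v \<Rightarrow> real" where
  "wt [] j = 0"
| "wt (x # xs) j = a x (src xs j) + wt xs j"

primrec walk :: "'v set \<Rightarrow> 'v list \<Rightarrow> 'v \<Rightarrow> bool" where
  "walk S [] j \<longleftrightarrow> j \<in> S"
| "walk S (x # xs) j \<longleftrightarrow> x \<in> S \<and> E x (src xs j) \<and> walk S xs j"

primrec follows :: "('v \<Rightarrow> 'v) \<Rightarrow> 'v list \<Rightarrow> 'v \<Rightarrow> bool" where
  "follows \<pi> [] j \<longleftrightarrow> True"
| "follows \<pi> (x # xs) j \<longleftrightarrow> src xs j = \<pi> x \<and> follows \<pi> xs j"

text \<open>The return to the start is left implicit, the end being \<open>hd xs\<close>. Thus
  \<open>distinct xs\<close> means that the closed walk is a simple cycle, and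
  \<open>length xs\<close> counts its edges.\<close>

definition closed_walk :: "'v set \<Rightarrow> 'v list \<Rightarrow> bool" where
  "closed_walk S xs \<longleftrightarrow> xs \<noteq> [] \<and> walk S xs (hd xs)"

abbreviation cwt :: "'v list \<Rightarrow> real" where
  "cwt xs \<equiv> wt xs (hd xs)"

definition mean_le :: "'v set \<Rightarrow> real \<Rightarrow> bool" where
  "mean_le S l \<longleftrightarrow> (\<forall>xs. closed_walk S xs \<longrightarrow> cwt xs \<le> l * length xs)"

text \<open>The walk is kept split at a visit \<open>k\<close> to \<open>Z\<close>, so that both
  halves can be altered while the visit survives.\<close>

definition via :: "'v set \<Rightarrow> 'v set \<Rightarrow> 'v \<Rightarrow> 'v \<Rightarrow> nat \<Rightarrow> real \<Rightarrow> bool" where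
  "via S Z i j N w \<longleftrightarrow> (\<exists>xs ys k. k \<in> Z \<and> walk S xs k \<and> src xs k = i \<and> walk S ys j \<and> src ys j = k \<and>
     N = length xs + length ys \<and> w = wt xs k + wt ys j)"

lemma wt_append [simp]: "wt (xs @ ys) j = wt xs (src ys j) + wt ys j"
  by (induction xs) auto

lemma walk_src: "walk S xs j \<Longrightarrow> src xs j \<in> S"
  by (cases xs) auto

lemma walk_append [simp]: "walk S (xs @ ys) j \<longleftrightarrow> walk S xs (src ys j) \<and> walk S ys j"
  by (induction xs) (auto dest: walk_src)

lemma follows_append [simp]: "follows \<pi> (xs @ ys) j \<longleftrightarrow> follows \<pi> xs (src ys j) \<and> follows \<pi> ys j"
  by (induction xs) auto

lemma walk_set: "walk S xs j \<Longrightarrow> set xs \<subseteq> S"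
  by (induction xs) auto

lemma walk_end: "walk S xs j \<Longrightarrow> j \<in> S"
  by (induction xs) auto

lemma walk_subset: "walk S xs j \<Longrightarrow> set xs \<subseteq> T \<Longrightarrow> j \<in> T \<Longrightarrow> walk T xs j"
  by (induction xs) auto

lemma walk_mono: "walk S xs j \<Longrightarrow> S \<subseteq> T \<Longrightarrow> walk T xs j"
  by (induction xs) auto

lemma closed_walk_mono: "closed_walk S xs \<Longrightarrow> S \<subseteq> T \<Longrightarrow> closed_walk T xs"
  unfolding closed_walk_def using walk_mono by blast

lemma closed_walk_subset: "closed_walk S xs \<Longrightarrow> set xs \<subseteq> T \<Longrightarrow> closed_walk T xs"
  unfolding closed_walk_def using walk_subset by (metis hd_in_set subsetD)

lemma closed_walk_set: "closed_walk S xs \<Longrightarrow> set xs \<subseteq> S"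
  unfolding closed_walk_def using walk_set by blast

lemma closed_walkI: "walk S xs k \<Longrightarrow> src xs k = k \<Longrightarrow> xs \<noteq> [] \<Longrightarrow> closed_walk S xs"
  unfolding closed_walk_def by (metis src_hd)

lemma mean_leD: "mean_le S l \<Longrightarrow> walk S xs k \<Longrightarrow> src xs k = k \<Longrightarrow> wt xs k \<le> l * length xs"
  by (cases "xs = []") (auto simp: mean_le_def closed_walk_def src_hd)

lemma closed_walk_rotate:
  assumes "closed_walk S (xs @ k # ys)"
  shows "walk S (k # ys @ xs) k" "wt (k # ys @ xs) k = cwt (xs @ k # ys)"
  using assms unfolding closed_walk_def by (cases xs; simp)+

text \<open>Pigeonhole on the first \<open>card S + 1\<close> vertices, the end \<open>j\<close>
  included. The last bound says that the cycle closes within \<open>card S\<close> steps, so that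
  the search can go on in \<open>vs\<close>.\<close>

lemma walk_repeat:
  assumes "walk S xs j" "finite S" "card S \<le> length xs"
  obtains us k bs vs where "walk S us k" "src us k = src xs j" "walk S (k # bs) k"
    "walk S vs j" "src vs j = k" "xs = us @ (k # bs) @ vs"
    "length us + length (k # bs) \<le> card S"
proof -
  let ?ys = "take (Suc (card S)) (xs @ [j])"
  have "set ?ys \<subseteq> S"
    using assms(1) walk_set walk_end by (metis (no_types, lifting) Un_insert_right append_Nil2
      insert_subset list.simps(15) order.trans set_append set_take_subset)
  moreover have "length ?ys = Suc (card S)" using assms by simp
  ultimately have "\<not> distinct ?ys"
    by (metis Suc_n_not_le_n assms(2) card_mono distinct_card)
  then obtain us bs ws k where d: "?ys = us @ [k] @ bs @ [k] @ ws"
    using not_distinct_decomp by blast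
  define zs where "zs = ws @ drop (Suc (card S)) (xs @ [j])"
  have e: "xs @ [j] = us @ (k # bs) @ (k # zs)"
    unfolding zs_def using d by (metis append.assoc append_Cons append_Nil append_take_drop_id)
  \<comment> \<open>\<open>zs\<close> still carries the appended end \<open>j\<close>; dropping it
    returns to the encoding of walks.\<close>
  define vs where "vs = butlast (k # zs)"
  have "k # zs = vs @ [last (k # zs)]" unfolding vs_def by (metis append_butlast_last_id list.discI)
  with e have x: "xs = us @ (k # bs) @ vs" and j: "k # zs = vs @ [j]"
    by (metis append.assoc butlast_snoc, metis (no_types, lifting) append.assoc last_snoc)
  have s: "src vs j = k" using j by (cases vs) auto
  have "length us + length (k # bs) \<le> card S"
    using d \<open>length ?ys = Suc (card S)\<close> by (metis (no_types, opaque_lifting) Suc_le_mono add_Suc_right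
      append_Cons append_Nil le_add1 length_Cons length_append add.assoc)
  then show ?thesis using that[of us k bs vs] assms(1) x s by auto
qed

text \<open>The list \<open>cs\<close> holds length and weight of cycles that can be removed independently of each other
  from a walk; \<open>N\<close> and \<open>w\<close> are what is left when all of them are removed.\<close>

definition flexible :: "'v set \<Rightarrow> 'v \<Rightarrow> 'v \<Rightarrow> (nat \<times> real) list \<Rightarrow> nat \<Rightarrow> real \<Rightarrow> bool" where
  "flexible S i j cs N w \<longleftrightarrow> (\<forall>ds. subseq ds cs \<longrightarrow> (\<exists>xs. walk S xs j \<and> src xs j = i \<and>
     length xs = N + sum_list (map fst ds) \<and> wt xs j = w + sum_list (map snd ds)))"

lemma flexible_append_walk:
  assumes "flexible S i k cs N w" "walk S vs j" "src vs j = k"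
  shows "flexible S i j cs (N + length vs) (w + wt vs j)"
  unfolding flexible_def
proof (intro allI impI)
  fix ds assume "subseq ds cs"
  then obtain xs where "walk S xs k \<and> src xs k = i \<and>
     length xs = N + sum_list (map fst ds) \<and> wt xs k = w + sum_list (map snd ds)"
    using assms(1) unfolding flexible_def by blast
  then show "\<exists>xs. walk S xs j \<and> src xs j = i \<and> length xs = N + length vs + sum_list (map fst ds) \<and>
    wt xs j = w + wt vs j + sum_list (map snd ds)"
    using assms(2,3) by (intro exI[of _ "xs @ vs"]) auto
qed

lemma flexible_mono: "flexible S i j cs N w \<Longrightarrow> S \<subseteq> T \<Longrightarrow> flexible T i j cs N w"
  unfolding flexible_def using walk_mono by meson

text \<open>Each cycle found by \<open>walk_repeat\<close> uses up at most \<open>card S\<close>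
  steps, and the next one is sought in what follows it. The cycles are therefore disjoint segments,
  any of which may be cut out.\<close>

lemma removable_cycles:
  assumes "finite S" "mean_le S l"
  shows "walk S xs j \<Longrightarrow> K * card S \<le> length xs \<Longrightarrow>
    \<exists>cs N w. length cs = K \<and> flexible S (src xs j) j cs N w \<and> N + sum_list (map fst cs) = length xs \<and>
      w + sum_list (map snd cs) = wt xs j \<and> (\<forall>c\<in>set cs. (1::nat) \<le> fst c \<and> snd c \<le> l * real (fst c))"
proof (induction K arbitrary: xs)
  case 0
  then show ?case
    by (intro exI[of _ "[]"] exI[of _ "length xs"] exI[of _ "wt xs j"])
       (use 0 in \<open>auto simp: flexible_def dest!: list_emb_Nil2\<close>)
next
  case (Suc K)
  then have "card S \<le> length xs" by simp
  then obtain us k bs vs where w: "walk S us k" "src us k = src xs j" "walk S (k # bs) k"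
    "walk S vs j" "src vs j = k" "xs = us @ (k # bs) @ vs" "length us + length (k # bs) \<le> card S"
    by (rule walk_repeat[OF Suc.prems(1) assms(1)])
  have "K * card S \<le> length vs" using w(6,7) Suc.prems(2) by auto
  from Suc.IH[OF w(4) this] obtain cs N v where IH: "length cs = K" "flexible S k j cs N v"
    "N + sum_list (map fst cs) = length vs" "v + sum_list (map snd cs) = wt vs j"
    "\<forall>c\<in>set cs. (1::nat) \<le> fst c \<and> snd c \<le> l * real (fst c)"
    using w(5) by auto
  let ?c = "(length (k # bs), wt (k # bs) k)"
  have "flexible S (src xs j) j (?c # cs) (length us + N) (wt us k + v)"
    unfolding flexible_def
  proof (intro allI impI)
    fix ds assume "subseq ds (?c # cs)"
    then consider "subseq ds cs" | ds' where "ds = ?c # ds'" "subseq ds' cs"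
      by (cases rule: list_emb.cases) auto
    then show "\<exists>ys. walk S ys j \<and> src ys j = src xs j \<and>
       length ys = length us + N + sum_list (map fst ds) \<and> wt ys j = wt us k + v + sum_list (map snd ds)"
    proof cases
      case 1
      then obtain ys where "walk S ys j \<and> src ys j = k \<and>
          length ys = N + sum_list (map fst ds) \<and> wt ys j = v + sum_list (map snd ds)"
        using IH(2) unfolding flexible_def by blast
      then show ?thesis using w by (intro exI[of _ "us @ ys"]) auto
    next
      case 2
      then obtain ys where "walk S ys j \<and> src ys j = k \<and>
          length ys = N + sum_list (map fst ds') \<and> wt ys j = v + sum_list (map snd ds')"
        using IH(2) unfolding flexible_def by blast
      then show ?thesis using w 2 by (intro exI[of _ "us @ (k # bs) @ ys"]) auto
    qed
  qed
  moreover have "wt (k # bs) k \<le> l * length (k # bs)"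
    using mean_leD[OF assms(2) w(3)] by simp
  ultimately show ?case
    using IH w(5,6)
    by (intro exI[of _ "?c # cs"] exI[of _ "length us + N"] exI[of _ "wt us k + v"]) auto
qed

text \<open>Cutting at the first visit confines the vertices of \<open>xs\<close> to
  \<open>S - Z\<close>, which improves the pigeonhole bound for this half.\<close>

lemma via_first:
  assumes "via S Z i j N w"
  obtains xs ys k where "k \<in> Z" "walk S xs k" "src xs k = i" "walk S ys j" "src ys j = k"
     "N = length xs + length ys" "w = wt xs k + wt ys j" "set xs \<inter> Z = {}"
proof -
  obtain xs ys k where v: "k \<in> Z" "walk S xs k" "src xs k = i" "walk S ys j" "src ys j = k"
     "N = length xs + length ys" "w = wt xs k + wt ys j"
    using assms unfolding via_def by blast
  show ?thesis
  proof (cases "\<exists>x\<in>set xs. x \<in> Z")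
    case False
    then show ?thesis using that[of k xs ys] v by blast
  next
    case True
    then obtain us x vs where "xs = us @ x # vs" "x \<in> Z" "\<forall>y\<in>set us. y \<notin> Z"
      using split_list_first_prop[of xs "\<lambda>x. x \<in> Z"] by blast
    then show ?thesis using that[of x us "x # vs @ ys"] v by auto
  qed
qed

text \<open>As long as the two halves together contain \<open>d\<close> removable cycles, some of
  these have total length divisible by \<open>d\<close> and can be cut out. A cycle weighs at most
  \<open>l\<close> times its length, so \<open>w - l * N\<close> does not drop, and the visit to
  \<open>Z\<close> is untouched.\<close>

lemma via_reduce:
  assumes fin: "finite S" and mean: "mean_le S l" and ZS: "Z \<subseteq> S" and d: "d > 0"
    and v: "via S Z i j N w"
  shows "\<exists>N' w'. via S Z i j N' w' \<and> N' mod d = N mod d \<and>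
    N' + card Z + 1 \<le> d * card S + card S \<and> w - l * N \<le> w' - l * N'"
  using v
proof (induction N arbitrary: w rule: less_induct)
  case (less N)
  show ?case
  proof (cases "N + card Z + 1 \<le> d * card S + card S")
    case True
    then show ?thesis using less.prems by (intro exI[of _ N] exI[of _ w]) simp
  next
    case False
    obtain xs ys k where v: "k \<in> Z" "walk S xs k" "src xs k = i" "walk S ys j" "src ys j = k"
      "N = length xs + length ys" "w = wt xs k + wt ys j" "set xs \<inter> Z = {}"
      by (rule via_first[OF less.prems])
    define m where "m = card S"
    define r where "r = card (S - Z)"
    have r: "r + card Z = m" unfolding r_def m_def using fin ZS
      by (metis card_Diff_subset card_mono finite_subset le_add_diff_inverse2)
    have "m > 0" unfolding m_def using v(1) ZS fin by (metis card_gt_0_iff empty_iff subsetD)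
    define K2 where "K2 = length ys div m"
    have K2: "K2 * m \<le> length ys" "length ys + 1 \<le> K2 * m + m"
      unfolding K2_def using \<open>m > 0\<close> mod_less_divisor[of m "length ys"] div_mult_mod_eq[of "length ys" m]
      by linarith+
    obtain cs2 N2 w2 where c2: "length cs2 = K2" "flexible S k j cs2 N2 w2"
      "N2 + sum_list (map fst cs2) = length ys" "w2 + sum_list (map snd cs2) = wt ys j"
      "\<forall>c\<in>set cs2. (1::nat) \<le> fst c \<and> snd c \<le> l * real (fst c)"
      using removable_cycles[OF fin mean v(4), of K2] K2(1) v(5) unfolding m_def by blast
    have "\<exists>cs1 N1 w1. length xs \<le> length cs1 * r + r \<and> flexible S i k cs1 N1 w1 \<and>
      N1 + sum_list (map fst cs1) = length xs \<and> w1 + sum_list (map snd cs1) = wt xs k \<and>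
      (\<forall>c\<in>set cs1. (1::nat) \<le> fst c \<and> snd c \<le> l * real (fst c))"
    proof (cases xs rule: rev_cases)
      case Nil
      then show ?thesis using v(2,3)
        by (intro exI[of _ "[]"] exI[of _ 0])
           (auto simp: flexible_def dest!: list_emb_Nil2)
    next
      case (snoc us y)
      \<comment> \<open>The last edge of the prefix enters \<open>Z\<close>; without it the prefix
        stays in \<open>S - Z\<close>, where a cycle costs at most \<open>r\<close> steps.\<close>
      have sub: "walk (S - Z) us y"
      proof (rule walk_subset)
        show "walk S us y" using snoc v(2) by simp
        show "set us \<subseteq> S - Z" "y \<in> S - Z" using walk_set[OF v(2)] v(8) snoc by auto
      qed
      have "S - Z \<noteq> {}" using walk_end[OF sub] by blast
      then have "r > 0" unfolding r_def using fin by (simp add: card_gt_0_iff)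
      define K1 where "K1 = length us div r"
      have K1: "K1 * r \<le> length us" "length us + 1 \<le> K1 * r + r"
        unfolding K1_def using \<open>r > 0\<close> mod_less_divisor[of r "length us"] div_mult_mod_eq[of "length us" r]
        by linarith+
      have "mean_le (S - Z) l"
        using mean closed_walk_mono[OF _ Diff_subset] unfolding mean_le_def by blast
      then obtain cs1 N1 w1 where c1: "length cs1 = K1" "flexible (S - Z) (src us y) y cs1 N1 w1"
        "N1 + sum_list (map fst cs1) = length us" "w1 + sum_list (map snd cs1) = wt us y"
        "\<forall>c\<in>set cs1. (1::nat) \<le> fst c \<and> snd c \<le> l * real (fst c)"
        using removable_cycles[OF finite_Diff[OF fin] _ sub, of l K1] K1(1) unfolding r_def by blast
      have "flexible S i k cs1 (N1 + length [y]) (w1 + wt [y] k)"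
        using flexible_append_walk[OF flexible_mono[OF c1(2) Diff_subset], of "[y]" k] v(2,3) snoc
        by simp
      then show ?thesis using c1 K1 snoc
        by (intro exI[of _ cs1] exI[of _ "N1 + length [y]"] exI[of _ "w1 + wt [y] k"]) auto
    qed
    then obtain cs1 N1 w1 where c1: "length xs \<le> length cs1 * r + r" "flexible S i k cs1 N1 w1"
      "N1 + sum_list (map fst cs1) = length xs" "w1 + sum_list (map snd cs1) = wt xs k"
      "\<forall>c\<in>set cs1. (1::nat) \<le> fst c \<and> snd c \<le> l * real (fst c)" by blast
    \<comment> \<open>With fewer than \<open>d\<close> cycles, the two length estimates and
      \<open>r + card Z = m\<close> would give the bound that fails in this case.\<close>
    have "d \<le> length (map fst (cs1 @ cs2))"
    proof (rule ccontr)
      assume "\<not> ?thesis"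
      then have "length cs1 + K2 + 1 \<le> d" using c2(1) by simp
      then have "(length cs1 + K2 + 1) * m \<le> d * m" by (rule mult_le_mono1)
      then have "length cs1 * m + K2 * m + m \<le> d * m" by (simp add: algebra_simps)
      moreover have "length cs1 * r \<le> length cs1 * m" using r by simp
      ultimately have "N + card Z + 1 \<le> d * m + m"
        using c1(1) K2(2) v(6) r by linarith
      then show False using False unfolding m_def by simp
    qed
    from sum_list_block_dvd[OF d this] obtain p q s where
      pqs: "map fst (cs1 @ cs2) = p @ q @ s" "q \<noteq> []" "d dvd sum_list q" by blast
    from pqs(1)[unfolded map_eq_append_conv append_eq_map_conv] obtain ps qs ss
      where cs: "cs1 @ cs2 = ps @ qs @ ss" "q = map fst qs" by blast
    have all: "\<forall>c\<in>set (cs1 @ cs2). (1::nat) \<le> fst c \<and> snd c \<le> l * real (fst c)" using c1 c2 by auto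
    then have qs: "\<forall>c\<in>set qs. (1::nat) \<le> fst c \<and> snd c \<le> l * real (fst c)" unfolding cs by auto
    have qpos: "sum_list q \<ge> 1"
      using qs pqs(2) unfolding cs(2) by (cases qs) auto
    have qw: "sum_list (map snd qs) \<le> l * sum_list q"
      using qs unfolding cs(2) by (induction qs) (auto simp: algebra_simps)
    \<comment> \<open>The block may straddle both lists; what remains splits into sublists of each,
      so the removal is done in the two halves separately.\<close>
    have "subseq (ps @ ss) (cs1 @ cs2)" unfolding cs by (intro list_emb_append_mono list_emb_append2) auto
    then obtain d1 d2 where ds: "ps @ ss = d1 @ d2" "subseq d1 cs1" "subseq d2 cs2"
      by (elim subseq_appendE) blast
    obtain xs' where xs': "walk S xs' k" "src xs' k = i" "length xs' = N1 + sum_list (map fst d1)"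
      "wt xs' k = w1 + sum_list (map snd d1)" using c1(2) ds(2) unfolding flexible_def by blast
    obtain ys' where ys': "walk S ys' j" "src ys' j = k" "length ys' = N2 + sum_list (map fst d2)"
      "wt ys' j = w2 + sum_list (map snd d2)" using c2(2) ds(3) unfolding flexible_def by blast
    define N' where "N' = length xs' + length ys'"
    define w' where "w' = wt xs' k + wt ys' j"
    have via: "via S Z i j N' w'"
      unfolding via_def N'_def w'_def using xs' ys' v(1) by blast
    have "sum_list (map fst (cs1 @ cs2)) = sum_list (map fst (ps @ ss)) + sum_list q"
      unfolding cs by simp
    then have NN: "N = N' + sum_list q"
      unfolding N'_def v(6) using xs'(3) ys'(3) c1(3) c2(3) unfolding ds(1) by simp
    have "sum_list (map snd (cs1 @ cs2)) = sum_list (map snd (ps @ ss)) + sum_list (map snd qs)"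
      unfolding cs by simp
    then have ww: "w = w' + sum_list (map snd qs)"
      unfolding w'_def v(7) using xs'(4) ys'(4) c1(4) c2(4) unfolding ds(1) by simp
    have "N' < N" using NN qpos by simp
    from less.IH[OF this via] obtain N'' w'' where n: "via S Z i j N'' w''" "N'' mod d = N' mod d"
      "N'' + card Z + 1 \<le> d * card S + card S" "w' - l * N' \<le> w'' - l * N''" by blast
    have "N' mod d = N mod d" using NN pqs(3) by auto
    moreover have "w - l * N \<le> w' - l * N'" using NN ww qw by (simp add: algebra_simps)
    ultimately show ?thesis using n by (metis order_trans)
  qed
qed

section \<open>Critical cycles\<close>

text \<open>Then \<open>l\<close> is the maximal cycle mean on \<open>S\<close>, attained by a
  simple cycle through exactly the vertices of \<open>Z\<close>.\<close>

definition critical :: "'v set \<Rightarrow> 'v set \<Rightarrow> real \<Rightarrow> bool" where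
  "critical S Z l \<longleftrightarrow> mean_le S l \<and> Z \<subseteq> S \<and>
     (\<exists>zs. distinct zs \<and> set zs = Z \<and> closed_walk Z zs \<and> cwt zs = l * card Z)"

lemma critical_at:
  assumes "critical S Z l" "k \<in> Z"
  obtains zs where "distinct zs" "set zs = Z" "walk Z zs k" "src zs k = k" "length zs = card Z"
    "wt zs k = l * card Z"
proof -
  obtain zs where zs: "distinct zs" "set zs = Z" "closed_walk Z zs" "cwt zs = l * card Z"
    using assms(1) unfolding critical_def by blast
  obtain us ws where us: "zs = us @ k # ws" using assms(2) zs(2) split_list by metis
  note r = closed_walk_rotate[OF zs(3)[unfolded us]]
  show ?thesis
  proof (rule that[of "k # ws @ us"])
    show "distinct (k # ws @ us)" "set (k # ws @ us) = Z" using zs(1,2) us by auto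
    then show "length (k # ws @ us) = card Z" using distinct_card by metis
    show "walk Z (k # ws @ us) k" using r(1) .
    show "wt (k # ws @ us) k = l * card Z" using r(2) zs(4) us by simp
  qed simp
qed

lemma critical_card_pos: "critical S Z l \<Longrightarrow> card Z > 0"
  unfolding critical_def closed_walk_def by (metis card_gt_0_iff finite_set set_empty)

text \<open>Turns of the critical cycle are inserted at the recorded visit; each has mean
  \<open>l\<close>.\<close>

lemma via_pad:
  assumes "critical S Z l" "via S Z i j N w"
  shows "via S Z i j (N + x * card Z) (w + l * (x * card Z))"
proof (induction x)
  case 0
  then show ?case using assms(2) by simp
next
  case (Suc x)
  then obtain xs ys k where v: "k \<in> Z" "walk S xs k" "src xs k = i" "walk S ys j" "src ys j = k"
     "N + x * card Z = length xs + length ys" "w + l * (x * card Z) = wt xs k + wt ys j"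
    unfolding via_def by blast
  obtain zs where zs: "walk Z zs k" "src zs k = k" "length zs = card Z" "wt zs k = l * card Z"
    by (rule critical_at[OF assms(1) v(1)])
  have "walk S zs k" using walk_mono zs(1) assms(1) unfolding critical_def by blast
  then show ?case unfolding via_def using v zs
    by (intro exI[of _ "xs @ zs"] exI[of _ ys] exI[of _ k]) (auto simp: algebra_simps)
qed

text \<open>\<open>via_reduce\<close> modulo \<open>card Z\<close> makes the length smaller than
  \<open>t + card Z\<close>; being congruent to \<open>t\<close> it is at most \<open>t\<close>, and
  turns of \<open>Z\<close> fill the gap. Neither operation lowers weight minus \<open>l\<close>
  times length.\<close>

lemma via_exact_length:
  assumes fin: "finite S" and crit: "critical S Z l" and v: "via S Z i j N w"
    and N: "N mod card Z = t mod card Z" and t: "card Z * card S + card S \<le> t + 2 * card Z"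
  shows "\<exists>w'. via S Z i j t w' \<and> w + l * (real t - real N) \<le> w'"
proof -
  have pos: "card Z > 0" using critical_card_pos[OF crit] .
  have "mean_le S l" "Z \<subseteq> S" using crit unfolding critical_def by auto
  from via_reduce[OF fin this pos v] obtain N' w' where n: "via S Z i j N' w'"
    "N' mod card Z = N mod card Z" "N' + card Z + 1 \<le> card Z * card S + card S"
    "w - l * N \<le> w' - l * N'" by blast
  have less: "N' < t + card Z" using n(3) t by linarith
  have m: "N' mod card Z = t mod card Z" using n(2) N by simp
  have "N' \<le> t"
  proof (rule ccontr)
    assume "\<not> N' \<le> t"
    then obtain q where "N' = t + card Z * q" using m by (metis nat_le_linear mod_eq_nat2E)
    then show False using less \<open>\<not> N' \<le> t\<close> by (cases q) auto
  qed
  then obtain x where x: "t = N' + x * card Z" using m by (metis mod_eq_nat2E mult.commute)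
  show ?thesis
    using via_pad[OF crit n(1), of x] n(4) unfolding x[symmetric]
    by (intro exI[of _ "w' + l * (x * card Z)"]) (auto simp: x algebra_simps)
qed

section \<open>Closed walks of maximal mean\<close>

lemma closed_walk_split:
  assumes "closed_walk S (us @ [k] @ bs @ [k] @ ws)"
  shows "closed_walk S (k # bs)" "closed_walk S (us @ k # ws)"
    "cwt (us @ [k] @ bs @ [k] @ ws) = cwt (k # bs) + cwt (us @ k # ws)"
    "follows \<pi> (us @ [k] @ bs @ [k] @ ws) (hd (us @ [k] @ bs @ [k] @ ws)) \<longleftrightarrow>
       follows \<pi> (k # bs) (hd (k # bs)) \<and> follows \<pi> (us @ k # ws) (hd (us @ k # ws))"
  using assms unfolding closed_walk_def by (cases us; auto)+

lemma finite_short_closed_walks: "finite S \<Longrightarrow> finite {c. closed_walk S c \<and> length c \<le> m}"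
  by (rule finite_subset[OF _ finite_lists_length_le[of S m]]) (auto dest: closed_walk_set)

lemma long_closed_walk_split:
  assumes "finite S" "closed_walk S c" "card S < length c"
  obtains b d where "closed_walk S b" "closed_walk S d" "length b \<le> card S" "length d < length c"
    "length c = length b + length d" "cwt c = cwt b + cwt d"
proof -
  have "\<not> distinct c"
    using assms card_mono closed_walk_set by (metis distinct_card not_less)
  have "walk S c (hd c)" using assms(2) unfolding closed_walk_def by simp
  then obtain us k bs vs where w: "walk S us k" "src us k = src c (hd c)" "walk S (k # bs) k"
    "walk S vs (hd c)" "src vs (hd c) = k" "c = us @ (k # bs) @ vs"
    "length us + length (k # bs) \<le> card S"
    by (rule walk_repeat[OF _ assms(1) less_imp_le[OF assms(3)]])
  have vs: "vs \<noteq> []" using w(6,7) assms(3) by auto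
  have c: "src c (hd c) = hd c" using assms(2) unfolding closed_walk_def by (simp add: src_hd)
  have "walk S (us @ vs) (hd c)" "src (us @ vs) (hd c) = hd c" using w c by auto
  then have "closed_walk S (us @ vs)" using vs by (intro closed_walkI) auto
  moreover have "hd (us @ vs) = hd c"
    using \<open>src (us @ vs) (hd c) = hd c\<close> vs src_hd[of "us @ vs" "hd c"] by simp
  moreover have "closed_walk S (k # bs)" using w(3) unfolding closed_walk_def by simp
  moreover have "wt c (hd c) = wt (k # bs) k + wt (us @ vs) (hd c)"
    by (subst (1) w(6)) (simp add: w(5))
  ultimately show ?thesis using that[of "k # bs" "us @ vs"] w(6,7) by simp
qed

text \<open>A maximum over the finitely many closed walks of length at most \<open>card S\<close>
  suffices: longer ones split into shorter ones, and the bound is additive.\<close>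

lemma mean_attained:
  assumes "finite S" "closed_walk S c"
  obtains l d where "mean_le S l" "closed_walk S d" "cwt d = l * length d"
proof -
  let ?C = "{c. closed_walk S c \<and> length c \<le> card S}"
  let ?f = "\<lambda>c. cwt c / length c"
  have fin: "finite ?C" using assms(1) by (rule finite_short_closed_walks)
  have "?C \<noteq> {}"
  proof (cases "length c \<le> card S")
    case False
    then have "card S < length c" by simp
    then obtain b where "closed_walk S b" "length b \<le> card S"
      by (rule long_closed_walk_split[OF assms])
    then show ?thesis by blast
  qed (use assms in blast)
  then have "Max (?f ` ?C) \<in> ?f ` ?C" using fin by (intro Max_in) auto
  then obtain d where d: "d \<in> ?C" "Max (?f ` ?C) = ?f d" by blast
  have "cwt b \<le> ?f d * length b" if "closed_walk S b" for b
    using that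
  proof (induction "length b" arbitrary: b rule: less_induct)
    case less
    show ?case
    proof (cases "length b \<le> card S")
      case True
      then have "?f b \<le> ?f d" using d(2) less.prems fin by (metis (mono_tags, lifting) Max_ge finite_imageI imageI mem_Collect_eq)
      moreover have "length b > 0" using less.prems unfolding closed_walk_def by simp
      ultimately show ?thesis by (simp add: divide_le_eq)
    next
      case False
      then have "card S < length b" by simp
      from assms(1) less.prems this obtain b1 b2 where b: "closed_walk S b1" "closed_walk S b2"
        "length b1 \<le> card S" "length b2 < length b" "length b = length b1 + length b2"
        "cwt b = cwt b1 + cwt b2" by (rule long_closed_walk_split)
      have "length b1 < length b" using b(3) False by simp
      from less.hyps[OF this b(1)] less.hyps[OF b(4,2)] show ?thesis
        unfolding b(5,6) of_nat_add distrib_left by (rule add_mono)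
    qed
  qed
  then have "mean_le S (?f d)" unfolding mean_le_def by blast
  moreover have "cwt d = ?f d * length d" using d(1) unfolding closed_walk_def by simp
  ultimately show ?thesis using that d(1) by blast
qed

section \<open>Certificates for a unique optimal permutation\<close>

text \<open>\<open>\<pi>\<close> is constrained on \<open>U\<close> only, unlike with
  \<open>permutes\<close>, so that permutations of disjoint sets can be glued. Here
  \<open>\<pi>\<close> attains the sum of \<open>\<mu>\<close>; \<open>strict\<close> will show that
  no other permutation of \<open>U\<close> along edges reaches it.\<close>

definition admissible :: "'v set \<Rightarrow> ('v \<Rightarrow> 'v) \<Rightarrow> ('v \<Rightarrow> real) \<Rightarrow> bool" where
  "admissible U \<pi> \<mu> \<longleftrightarrow> bij_betw \<pi> U U \<and> (\<forall>u\<in>U. E u (\<pi> u)) \<and> (\<Sum>u\<in>U. a u (\<pi> u)) = (\<Sum>u\<in>U. \<mu> u)"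

definition strict :: "'v set \<Rightarrow> ('v \<Rightarrow> 'v) \<Rightarrow> ('v \<Rightarrow> real) \<Rightarrow> bool" where
  "strict U \<pi> \<mu> \<longleftrightarrow> (\<forall>c. closed_walk U c \<longrightarrow> cwt c \<le> sum_list (map \<mu> c) \<and>
     (cwt c = sum_list (map \<mu> c) \<longrightarrow> follows \<pi> c (hd c)))"

lemma follows_cong: "(\<And>x. x \<in> set xs \<Longrightarrow> \<pi> x = \<rho> x) \<Longrightarrow> follows \<pi> xs j = follows \<rho> xs j"
  by (induction xs) auto

lemma ex_follows: "distinct xs \<Longrightarrow> \<exists>\<pi>. follows \<pi> xs j"
proof (induction xs)
  case (Cons x xs)
  then obtain \<pi> where "follows \<pi> xs j" by auto
  moreover have "follows (\<pi>(x := src xs j)) xs j = follows \<pi> xs j"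
    using Cons.prems by (intro follows_cong) auto
  ultimately show ?case by (metis follows.simps(2) fun_upd_same)
qed auto

lemma follows_sum:
  "distinct xs \<Longrightarrow> follows \<pi> xs j \<Longrightarrow> wt xs j = (\<Sum>x\<in>set xs. a x (\<pi> x))"
  by (induction xs) auto

lemma follows_edges: "follows \<pi> xs j \<Longrightarrow> walk S xs j \<Longrightarrow> x \<in> set xs \<Longrightarrow> E x (\<pi> x)"
  by (induction xs) auto

lemma follows_image: "follows \<pi> xs j \<Longrightarrow> insert (src xs j) (\<pi> ` set xs) = insert j (set xs)"
  by (induction xs) auto

text \<open>The last vertex is sent to the first, so \<open>\<pi>\<close> maps the finite vertex set
  onto itself and is injective on it.\<close>

lemma admissible_cycle:
  assumes "distinct zs" "closed_walk S zs" "follows \<pi> zs (hd zs)" "cwt zs = (\<Sum>u\<in>set zs. \<mu> u)"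
  shows "admissible (set zs) \<pi> \<mu>"
proof -
  have ne: "zs \<noteq> []" and w: "walk S zs (hd zs)" using assms(2) unfolding closed_walk_def by auto
  have "\<pi> (last zs) = hd zs"
    using assms(3) append_butlast_last_id[OF ne] follows_append[of \<pi> "butlast zs" "[last zs]" "hd zs"]
    by auto
  then have "hd zs \<in> \<pi> ` set zs" using last_in_set[OF ne] by (metis imageI)
  then have im: "\<pi> ` set zs = set zs"
    using follows_image[OF assms(3)] ne by (metis hd_in_set insert_absorb src_hd)
  then have "bij_betw \<pi> (set zs) (set zs)"
    by (simp add: bij_betw_def eq_card_imp_inj_on)
  then show ?thesis
    unfolding admissible_def using follows_sum[OF assms(1,3)] follows_edges[OF assms(3) w] assms(4)
    by auto
qed

lemma not_follows: "\<not> follows \<pi> c j \<Longrightarrow> \<exists>p x q. c = p @ x # q \<and> src q j \<noteq> \<pi> x"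
proof (induction c)
  case (Cons y c)
  show ?case
  proof (cases "src c j = \<pi> y")
    case True
    then obtain p x q where "c = p @ x # q \<and> src q j \<noteq> \<pi> x" using Cons by auto
    then show ?thesis by (intro exI[of _ "y # p"]) auto
  next
    case False
    then show ?thesis by (intro exI[of _ "[]"]) auto
  qed
qed auto

lemma follows_rotate:
  "follows \<pi> (xs @ k # ys) (hd (xs @ k # ys)) \<Longrightarrow> follows \<pi> (k # ys @ xs) k"
  by (cases xs) auto

text \<open>Taking a shortest cycle of maximal mean excludes chords of maximal mean.\<close>

lemma critical_exists:
  assumes fin: "finite S" and c0: "closed_walk S c0"
  obtains l Z \<pi> where "critical S Z l" "admissible Z \<pi> (\<lambda>_. l)" "strict Z \<pi> (\<lambda>_. l)"
proof -
  obtain l d where l: "mean_le S l" and d: "closed_walk S d" "cwt d = l * length d"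
    by (rule mean_attained[OF fin c0])
  let ?P = "\<lambda>c. closed_walk S c \<and> cwt c = l * length c"
  from d have "?P d" by simp
  then obtain zs where zs: "closed_walk S zs" "cwt zs = l * length zs"
    and min: "\<And>b. ?P b \<Longrightarrow> length zs \<le> length b"
    using ex_has_least_nat[of ?P d length] by blast
  have max: "cwt b \<le> l * length b" if "closed_walk S b" for b
    using l that unfolding mean_le_def by blast
  \<comment> \<open>A repeated vertex would split \<open>zs\<close> into two closed walks, both of
    mean \<open>l\<close>, against minimality.\<close>
  have dist: "distinct zs"
  proof (rule ccontr)
    assume "\<not> distinct zs"
    then obtain us k bs ws where e: "zs = us @ [k] @ bs @ [k] @ ws"
      using not_distinct_decomp by blast
    note s = closed_walk_split[OF zs(1)[unfolded e]]
    have "cwt (k # bs) + cwt (us @ k # ws) = l * length (k # bs) + l * length (us @ k # ws)"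
      using zs(2) s(3) unfolding e by (simp add: algebra_simps)
    then have "cwt (k # bs) = l * length (k # bs)"
      using max[OF s(1)] max[OF s(2)] by linarith
    then have "length zs \<le> length (k # bs)" using min s(1) by blast
    then show False unfolding e by simp
  qed
  define Z where "Z = set zs"
  have ZS: "Z \<subseteq> S" unfolding Z_def using closed_walk_set[OF zs(1)] .
  have Zw: "closed_walk Z zs" using closed_walk_subset[OF zs(1)] Z_def by simp
  have card: "card Z = length zs" unfolding Z_def using distinct_card[OF dist] .
  have crit: "critical S Z l"
    unfolding critical_def using l ZS dist Zw zs(2) card Z_def by auto
  obtain \<pi> where \<pi>: "follows \<pi> zs (hd zs)" using ex_follows[OF dist] by blast
  have adm: "admissible Z \<pi> (\<lambda>_. l)"
    unfolding Z_def using admissible_cycle[OF dist zs(1) \<pi>, of "\<lambda>_. l"] zs(2) card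
    by (simp add: Z_def mult.commute)
  \<comment> \<open>Suppose that \<open>c\<close> leaves the cycle by an edge from \<open>x\<close>
    to \<open>v\<close>. This chord and the part of \<open>zs\<close> from \<open>v\<close> to
    \<open>x\<close> form \<open>x # as\<close>; the rests of \<open>c\<close> and \<open>zs\<close>
    form another closed walk. Together they have the length and weight of \<open>c\<close> and
    \<open>zs\<close>, so both have mean \<open>l\<close>, but \<open>x # as\<close> is shorter than
    \<open>zs\<close>.\<close>
  have "follows \<pi> c (hd c)" if c: "closed_walk Z c" "cwt c = l * length c" for c
  proof (rule ccontr)
    assume "\<not> follows \<pi> c (hd c)"
    then obtain p x q where pq: "c = p @ x # q" "src q (hd c) \<noteq> \<pi> x" using not_follows by blast
    define v where "v = src (q @ p) x"
    have v: "v \<noteq> \<pi> x" unfolding v_def using pq by (cases p) auto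
    note r = closed_walk_rotate[OF c(1)[unfolded pq(1)]]
    have w: "walk Z (q @ p) x" and xZ: "x \<in> Z" and e: "E x v" using r(1) unfolding v_def by auto
    have wx: "a x v + wt (q @ p) x = l * (1 + length (q @ p))"
      using r(2) c(2) unfolding pq(1) v_def by (simp add: algebra_simps)
    have "v \<in> Z" using walk_src[OF w] unfolding v_def .
    then obtain us ws where zv: "zs = us @ v # ws" unfolding Z_def by (metis split_list)
    let ?zs = "v # ws @ us"
    note rz = closed_walk_rotate[OF Zw[unfolded zv]]
    have \<pi>z: "follows \<pi> ?zs v" using follows_rotate \<pi> unfolding zv by blast
    have "x \<in> set ?zs" using xZ unfolding Z_def zv by auto
    then obtain as bs where ab: "?zs = as @ x # bs" by (metis split_list)
    \<comment> \<open>Otherwise \<open>v\<close> would be the successor \<open>\<pi> x\<close> of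
      \<open>x\<close> on the cycle.\<close>
    have bs: "bs \<noteq> []" using \<pi>z v unfolding ab by auto
    have wz: "walk Z (as @ x # bs) v" using rz(1) unfolding ab .
    have wtz: "wt (as @ x # bs) v = l * length zs" using rz(2) zs(2) unfolding ab zv by simp
    have sas: "src as x = v" using ab by (cases as) auto
    have lzs: "length zs = length as + 1 + length bs"
      using arg_cong[OF ab, of length] unfolding zv by simp
    have c1: "walk Z (x # as) x" using wz xZ e sas by auto
    have "walk Z ((x # bs) @ (q @ p)) x" using wz w unfolding v_def by auto
    then have "walk S ((x # bs) @ (q @ p)) x" using walk_mono ZS by blast
    then have "wt ((x # bs) @ (q @ p)) x \<le> l * length ((x # bs) @ (q @ p))"
      by (rule mean_leD[OF l]) simp
    then have "wt (x # bs) v + wt (q @ p) x \<le> l * length ((x # bs) @ (q @ p))"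
      unfolding v_def by simp
    moreover have "wt as x + wt (x # bs) v = l * length zs" using wtz by simp
    ultimately have "a x v + wt as x \<ge> l * length (x # as)"
      using wx unfolding lzs by (simp add: algebra_simps)
    then have "cwt (x # as) \<ge> l * length (x # as)" using sas by simp
    moreover have cS: "closed_walk S (x # as)"
      using closed_walkI[OF walk_mono[OF c1 ZS]] by simp
    ultimately have "?P (x # as)" using max[OF cS] by simp
    then have "length zs \<le> length (x # as)" by (rule min)
    then show False using lzs bs by (cases bs) auto
  qed
  then have "strict Z \<pi> (\<lambda>_. l)"
    unfolding strict_def using max closed_walk_mono[OF _ ZS]
    by (simp add: map_replicate_const sum_list_replicate mult.commute)
  with crit adm show ?thesis using that by blast
qed

definition violates :: "('v \<Rightarrow> 'v) \<Rightarrow> ('v \<Rightarrow> real) \<Rightarrow> 'v list \<Rightarrow> bool" where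
  "violates \<pi> \<mu> c \<longleftrightarrow> sum_list (map \<mu> c) < cwt c \<or> (sum_list (map \<mu> c) = cwt c \<and> \<not> follows \<pi> c (hd c))"

lemma strict_iff: "strict U \<pi> \<mu> \<longleftrightarrow> (\<forall>c. closed_walk U c \<longrightarrow> \<not> violates \<pi> \<mu> c)"
  unfolding strict_def violates_def by fastforce

text \<open>When a closed walk is split at a repeated vertex and neither part violates, the whole
  does not either; hence a shortest violating closed walk is simple.\<close>

lemma violating_cycle:
  assumes "\<not> strict U \<pi> \<mu>"
  obtains c where "closed_walk U c" "violates \<pi> \<mu> c" "distinct c"
proof -
  let ?P = "\<lambda>c. closed_walk U c \<and> violates \<pi> \<mu> c"
  obtain d where "?P d" using assms unfolding strict_iff by blast
  then obtain c where c: "closed_walk U c" "violates \<pi> \<mu> c"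
    and min: "\<And>b. ?P b \<Longrightarrow> length c \<le> length b"
    using ex_has_least_nat[of ?P d length] by blast
  have "distinct c"
  proof (rule ccontr)
    assume "\<not> distinct c"
    then obtain us k bs ws where e: "c = us @ [k] @ bs @ [k] @ ws"
      using not_distinct_decomp by blast
    note s = closed_walk_split[OF c(1)[unfolded e]]
    have "\<not> violates \<pi> \<mu> (k # bs)" "\<not> violates \<pi> \<mu> (us @ k # ws)"
      using min[of "k # bs"] min[of "us @ k # ws"] s(1,2) unfolding e by auto
    moreover have "sum_list (map \<mu> c) = sum_list (map \<mu> (k # bs)) + sum_list (map \<mu> (us @ k # ws))"
      unfolding e by simp
    moreover have "cwt c = cwt (k # bs) + cwt (us @ k # ws)" unfolding e by (rule s(3))
    moreover have "follows \<pi> c (hd c) \<longleftrightarrow> follows \<pi> (k # bs) (hd (k # bs)) \<and> follows \<pi> (us @ k # ws) (hd (us @ k # ws))"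
      unfolding e by (rule s(4))
    ultimately have "\<not> violates \<pi> \<mu> c"
      unfolding violates_def by argo
    then show False using c(2) by simp
  qed
  with c show ?thesis using that by blast
qed

lemma walk_sequence:
  fixes f :: "nat \<Rightarrow> 'v"
  shows "(\<And>i. i < M \<Longrightarrow> f i \<in> S \<and> E (f i) (f (Suc i))) \<Longrightarrow> f M \<in> S \<Longrightarrow> walk S (map f [0..<M]) (f M)"
    and "wt (map f [0..<M]) (f M) = (\<Sum>i<M. a (f i) (f (Suc i)))"
    and "follows \<pi> (map f [0..<M]) (f M) \<longleftrightarrow> (\<forall>i<M. f (Suc i) = \<pi> (f i))"
  by (induction M) (auto simp: less_Suc_eq)

lemma permutes_funpow_eq_id:
  assumes "finite U" "\<sigma> permutes U"
  obtains M where "M > 0" "\<sigma> ^^ M = id"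
proof -
  have p: "(\<sigma> ^^ i) permutes U" for i
    by (induction i) (simp_all only: funpow.simps permutes_id permutes_compose assms(2))
  have "finite (range (\<lambda>i. \<sigma> ^^ i))"
    by (rule finite_subset[OF _ finite_permutations[OF assms(1)]]) (use p in auto)
  then have "\<not> inj (\<lambda>i. \<sigma> ^^ i)" using finite_imageD by blast
  then obtain i k where ik: "i < k" "\<sigma> ^^ i = \<sigma> ^^ k" unfolding inj_def by (metis nat_neq_iff)
  have "(\<sigma> ^^ (k - i)) x = x" for x
  proof -
    have "(\<sigma> ^^ i) ((\<sigma> ^^ (k - i)) x) = (\<sigma> ^^ k) x"
      using ik(1) funpow_add[of i "k - i" \<sigma>] by (simp add: fun_eq_iff)
    then show ?thesis using permutes_inj[OF p[of i]] ik(2) by (simp add: inj_eq)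
  qed
  then have "\<sigma> ^^ (k - i) = id" by (simp add: fun_eq_iff)
  then show ?thesis using that[of "k - i"] ik(1) by simp
qed

text \<open>Averaging over all starting points of the closed walks along the permutation avoids its
  decomposition into cycles.\<close>

lemma strict_permutes:
  assumes fin: "finite U" and perm: "\<sigma> permutes U" and edges: "\<And>u. u \<in> U \<Longrightarrow> E u (\<sigma> u)"
    and strict: "strict U \<pi> \<mu>"
  shows "(\<Sum>u\<in>U. a u (\<sigma> u)) \<le> (\<Sum>u\<in>U. \<mu> u)"
    and "(\<Sum>u\<in>U. a u (\<sigma> u)) = (\<Sum>u\<in>U. \<mu> u) \<Longrightarrow> u \<in> U \<Longrightarrow> \<sigma> u = \<pi> u"
proof -
  \<comment> \<open>A common period gives all the closed walks \<open>c u\<close> the same length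
    \<open>M\<close>, whatever the cycle lengths of \<open>\<sigma>\<close>.\<close>
  obtain M where M: "M > 0" "\<sigma> ^^ M = id" by (rule permutes_funpow_eq_id[OF fin perm])
  define f where "f = (\<lambda>u i. (\<sigma> ^^ i) u)"
  define c where "c = (\<lambda>u. map (f u) [0..<M])"
  have fU: "f u i \<in> U" if "u \<in> U" for u i
    unfolding f_def using that perm by (induction i) (auto simp: permutes_in_image)
  have fS: "f u (Suc i) = \<sigma> (f u i)" for u i unfolding f_def by simp
  have f0: "f u M = u" "f u 0 = u" for u unfolding f_def using M by auto
  have hd: "hd (c u) = u" and ne: "c u \<noteq> []" for u
    unfolding c_def using M f0 by (auto simp: hd_map)
  have closed: "closed_walk U (c u)" if "u \<in> U" for u
    using walk_sequence(1)[of M "f u" U] fU[OF that] edges fS f0 ne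
    unfolding closed_walk_def hd by (simp add: c_def that)
  have cwt: "cwt (c u) = (\<Sum>i<M. a (f u i) (\<sigma> (f u i)))" for u
    unfolding hd using walk_sequence(2)[where M = M and f = "f u"] unfolding f0 fS c_def .
  have mu: "sum_list (map \<mu> (c u)) = (\<Sum>i<M. \<mu> (f u i))" for u
    unfolding c_def by (simp add: sum_list_sum_nth atLeast0LessThan)
  \<comment> \<open>For fixed \<open>i\<close> the map taking \<open>u\<close> to
    \<open>f u i\<close> permutes \<open>U\<close>, so each of the \<open>M\<close> positions
    contributes a full sum over \<open>U\<close>.\<close>
  have inv: "(\<Sum>u\<in>U. g (f u i)) = (\<Sum>u\<in>U. g u)" for g :: "'v \<Rightarrow> real" and i
  proof (induction i)
    case (Suc i)
    have "f u (Suc i) = f (\<sigma> u) i" for u unfolding f_def by (simp add: funpow_swap1)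
    then have "(\<Sum>u\<in>U. g (f u (Suc i))) = (\<Sum>u\<in>U. ((\<lambda>u. g (f u i)) \<circ> \<sigma>) u)" by simp
    also have "\<dots> = (\<Sum>u\<in>U. g (f u i))" using sum.permute[OF perm] by metis
    finally show ?case using Suc by simp
  qed (simp add: f0)
  have tot: "(\<Sum>u\<in>U. \<Sum>i<M. g (f u i)) = M * (\<Sum>u\<in>U. g u)" for g :: "'v \<Rightarrow> real"
    by (subst sum.swap) (simp add: inv)
  have le: "cwt (c u) \<le> sum_list (map \<mu> (c u))" if "u \<in> U" for u
    using strict closed[OF that] unfolding strict_def by blast
  have sums: "(\<Sum>u\<in>U. cwt (c u)) = M * (\<Sum>u\<in>U. a u (\<sigma> u))"
    "(\<Sum>u\<in>U. sum_list (map \<mu> (c u))) = M * (\<Sum>u\<in>U. \<mu> u)"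
    unfolding cwt mu using tot[of "\<lambda>u. a u (\<sigma> u)"] tot[of \<mu>] by auto
  show "(\<Sum>u\<in>U. a u (\<sigma> u)) \<le> (\<Sum>u\<in>U. \<mu> u)"
    using sum_mono[of U "\<lambda>u. cwt (c u)", OF le] M(1) unfolding sums by simp
  assume eq: "(\<Sum>u\<in>U. a u (\<sigma> u)) = (\<Sum>u\<in>U. \<mu> u)" and u: "u \<in> U"
  \<comment> \<open>The inequality holds for each start and the totals agree, so it is tight for
    each start.\<close>
  have "cwt (c u) = sum_list (map \<mu> (c u))"
  proof (rule ccontr)
    assume "\<not> ?thesis"
    then have "cwt (c u) < sum_list (map \<mu> (c u))" using le[OF u] by simp
    then have "(\<Sum>u\<in>U. cwt (c u)) < (\<Sum>u\<in>U. sum_list (map \<mu> (c u)))"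
      using u le by (intro sum_strict_mono_ex1[OF fin]) auto
    then show False unfolding sums eq by simp
  qed
  moreover have "cwt (c u) = sum_list (map \<mu> (c u)) \<longrightarrow> follows \<pi> (c u) (hd (c u))"
    using strict closed[OF u] unfolding strict_def by blast
  ultimately have "follows \<pi> (c u) u" by (simp only: hd simp_thms)
  then have "\<forall>i<M. f u (Suc i) = \<pi> (f u i)"
    using walk_sequence(3)[of \<pi> "f u" M] by (simp add: f0 c_def)
  then have "f u (Suc 0) = \<pi> (f u 0)" using M(1) by blast
  then show "\<sigma> u = \<pi> u" unfolding f_def by simp
qed

section \<open>Selection of cycles\<close>

lemma walk_concat_replicate:
  assumes "walk S c z" "src c z = z"
  shows "walk S (concat (replicate x c)) z" "src (concat (replicate x c)) z = z"
    "wt (concat (replicate x c)) z = x * wt c z"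
proof -
  show s: "src (concat (replicate x c)) z = z" for x using assms(2) by (induction x) auto
  show "walk S (concat (replicate x c)) z" using assms s walk_end by (induction x) auto
  show "wt (concat (replicate x c)) z = x * wt c z" using s by (induction x) (auto simp: algebra_simps)
qed

text \<open>The walk need not visit \<open>z\<close> itself: one turn of \<open>Z\<close> from its
  visit \<open>k\<close> leads there, and the turns of \<open>c\<close> inserted at \<open>z\<close>
  pass through \<open>y\<close>. In this way a walk through \<open>Z\<close> becomes one through
  \<open>C\<close>.\<close>

lemma via_insert_cycle:
  fixes w l :: real
  assumes v: "via S Z i j N w" and crit: "critical S Z l" and SD: "S \<subseteq> D" and c: "closed_walk D c"
    and z: "z \<in> set c" "z \<in> Z" and y: "y \<in> set c" "y \<in> C" and x: "x > 0"
  shows "via D C i j (N + card Z + x * length c) (w + l * card Z + x * cwt c)"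
proof -
  obtain xs ys k where v: "k \<in> Z" "walk S xs k" "src xs k = i" "walk S ys j" "src ys j = k"
     "N = length xs + length ys" "w = wt xs k + wt ys j"
    using v unfolding via_def by blast
  obtain zs where zs: "set zs = Z" "walk Z zs k" "src zs k = k" "length zs = card Z"
    "wt zs k = l * card Z" by (rule critical_at[OF crit v(1)])
  obtain as bs where ab: "zs = as @ z # bs" using z(2) zs(1) split_list by metis
  obtain p q where pq: "c = p @ z # q" using z(1) split_list by metis
  define c' where "c' = z # q @ p"
  have c': "walk D c' z" "wt c' z = cwt c" "src c' z = z" "length c' = length c" "set c' = set c"
    using closed_walk_rotate[OF c[unfolded pq]] unfolding c'_def pq by auto
  obtain c1 c2 where c12: "c' = c1 @ y # c2" using y(1) c'(5) split_list by metis
  obtain x' where x': "x = Suc x'" using x by (cases x) auto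
  define r where "r = concat (replicate x' c')"
  note r = walk_concat_replicate[OF c'(1,3), of x', folded r_def]
  have rl: "length r = x' * length c" unfolding r_def using c'(4) by (induction x') auto
  have sc: "src c1 y = z" using c'(3) unfolding c12 by simp
  have sa: "src as z = k" using zs(3) unfolding ab by simp
  have D: "walk D zs k" "walk D xs k" "walk D ys j"
    using walk_mono SD zs(2) v(2,4) crit unfolding critical_def by (meson subset_trans)+
  show ?thesis unfolding via_def
  proof (intro exI conjI)
    show "y \<in> C" by fact
    show "walk D (xs @ as @ c1) y" using D c'(1) sc sa unfolding ab c12 by auto
    show "src (xs @ as @ c1) y = i" using v(3) sc sa by simp
    show "walk D ((y # c2) @ r @ (z # bs) @ ys) j"
      using D c'(1) r v(5) unfolding ab c12 by auto
    show "src ((y # c2) @ r @ (z # bs) @ ys) j = y" by simp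
    have "length zs = card Z" "length c' = length c" by fact+
    then show "N + card Z + x * length c = length (xs @ as @ c1) + length ((y # c2) @ r @ (z # bs) @ ys)"
      unfolding v(6) x' using rl unfolding ab c12 by simp
    have "wt zs k = wt as z + wt (z # bs) k" "wt c' z = wt c1 y + wt (y # c2) z"
      unfolding ab c12 by auto
    then show "w + l * card Z + x * cwt c =
      wt (xs @ as @ c1) y + wt ((y # c2) @ r @ (z # bs) @ ys) j"
      unfolding v(7) x' using zs(5) c'(2) r(2,3) sc sa v(5) by (simp add: algebra_simps)
  qed
qed

text \<open>A distinct list has at most \<open>card (D - C)\<close> entries off \<open>C\<close>,
  and each of them loses \<open>m - l\<close> against the value \<open>m\<close>.\<close>

lemma sum_list_two_levels:
  fixes m l :: real
  assumes "distinct c" "set c \<subseteq> D" "finite D" "l \<le> m"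
  shows "m * length c - (m - l) * card (D - C) \<le> sum_list (map (\<lambda>x. if x \<in> C then m else l) c)"
proof -
  have "sum_list (map (\<lambda>x. if x \<in> C then m else l) c) = m * length c - (m - l) * length (filter (\<lambda>x. x \<notin> C) c)"
    by (induction c) (auto simp: algebra_simps)
  moreover have "set (filter (\<lambda>x. x \<notin> C) c) \<subseteq> D - C" using assms(2) by auto
  then have "length (filter (\<lambda>x. x \<notin> C) c) \<le> card (D - C)"
    using card_mono[OF finite_Diff[OF assms(3)]] distinct_card[OF distinct_filter[OF assms(1)]]
    by metis
  then have "(m - l) * length (filter (\<lambda>x. x \<notin> C) c) \<le> (m - l) * card (D - C)"
    using assms(4) by (intro mult_left_mono) auto
  ultimately show ?thesis by linarith
qed

text \<open>One turn of the cycle \<open>Z\<close> is traded for a turn of \<open>Z\<close> with \<open>card C\<close> copies of \<open>c\<close> inserted; the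
  number of copies keeps the length fixed modulo \<open>card C\<close>.\<close>

lemma via_dominated:
  assumes fin: "finite D" and critD: "critical D C m" and critS: "critical S Z l" and SD: "S \<subseteq> D - C"
    and lm: "l \<le> m" and c: "closed_walk D c" "distinct c" "set c \<inter> C \<noteq> {}" "set c \<inter> Z \<noteq> {}"
    and cw: "sum_list (map (\<lambda>x. if x \<in> C then m else l) c) \<le> cwt c"
    and v: "via S Z i j t w" and n: "card D \<le> n" and t: "(n - 1)\<^sup>2 + 1 \<le> t"
  shows "\<exists>w'\<ge>w. via D C i j t w'"
proof -
  define d b s z where "d = card C" and "b = card (D - C)" and "s = card S" and "z = card Z"
  have d: "d > 0" unfolding d_def using critical_card_pos[OF critD] .
  have z: "z > 0" unfolding z_def using critical_card_pos[OF critS] .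
  have ZS: "Z \<subseteq> S" and CD: "C \<subseteq> D" and ml: "mean_le S l" using critD critS unfolding critical_def by auto
  have finS: "finite S" using fin SD finite_subset by blast
  have zs: "z \<le> s" unfolding z_def s_def using card_mono[OF finS ZS] .
  have sb: "s \<le> b" unfolding s_def b_def using card_mono[OF _ SD] fin by simp
  have db: "d + b = card D" unfolding d_def b_def using fin CD
    by (metis card_Diff_subset card_mono finite_subset le_add_diff_inverse)
  \<comment> \<open>The bound is taken at \<open>s + 1\<close>, which is at most \<open>n\<close>
    because \<open>S\<close> misses the nonempty \<open>C\<close>. The extra unit yields the level
    bound for the target length \<open>t - z\<close>, leaving room for one turn of
    \<open>Z\<close>.\<close>
  have level: "z * s + s \<le> t + z"
  proof -
    have "z * (s + 1) + (s + 1) \<le> t + 2 * z"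
      by (rule level_length_bound[where n = n]) (use zs sb db d z n t in auto)
    then show ?thesis by simp
  qed
  have "z * s \<ge> z" using zs z by simp
  then have tz: "z \<le> t" using level zs by linarith
  have "\<exists>w'. via S Z i j (t - z) w' \<and> w + l * (real (t - z) - real t) \<le> w'"
    using level tz unfolding z_def s_def
    by (intro via_exact_length[OF finS critS v]) (auto simp: le_mod_geq)
  then obtain w2 where w2: "via S Z i j (t - z) w2" "w + l * (real (t - z) - real t) \<le> w2" by blast
  \<comment> \<open>The walk still passes through \<open>Z\<close>, but the reduction is modulo the
    length \<open>d\<close> of \<open>C\<close>; the length after the insertion is then congruent to
    \<open>t\<close> modulo \<open>d\<close>.\<close>
  from via_reduce[OF finS ml ZS d w2(1)] obtain N3 w3 where w3: "via S Z i j N3 w3"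
    "N3 mod d = (t - z) mod d" "N3 + z + 1 \<le> d * s + s" "w2 - l * real (t - z) \<le> w3 - l * N3"
    unfolding z_def s_def by blast
  obtain x y where xy: "x \<in> set c" "x \<in> Z" "y \<in> set c" "y \<in> C" using c(3,4) by blast
  have "S \<subseteq> D" using SD by blast
  from via_insert_cycle[OF w3(1) critS this c(1) xy d]
  have v4: "via D C i j (N3 + z + d * length c) (w3 + l * z + d * cwt c)" unfolding z_def .
  have "(N3 + z) mod d = (t - z + z) mod d" using w3(2) by (rule mod_add_cong) simp
  then have md: "(N3 + z + d * length c) mod d = t mod d" using tz by simp
  have "d * card D + card D \<le> t + 2 * d"
    by (rule level_length_bound[OF _ n _ d t]) (use db zs sb z n in auto)
  with via_exact_length[OF fin critD v4, of t] md obtain w5 where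
    w5: "via D C i j t w5" "w3 + l * z + d * cwt c + m * (real t - real (N3 + z + d * length c)) \<le> w5"
    unfolding d_def by blast
  have "d * s + s \<le> d * b + b" using sb by (simp add: add_mono)
  moreover have "2 * d * b + b \<le> t + 1"
    by (rule two_level_length_bound[where n = n]) (use db d z zs sb n t in auto)
  \<comment> \<open>The weight grows by at least \<open>(m - l) * (t - N3 - z - d * b)\<close>:
    steps are refilled at rate \<open>m\<close> instead of \<open>l\<close>, and each of the
    \<open>d\<close> turns of \<open>c\<close> loses at most \<open>(m - l) * b\<close>. The present
    inequality makes this nonnegative.\<close>
  ultimately have "N3 + z + d * b \<le> t" using w3(3) by linarith
  then have "real (N3 + z + d * b) \<le> real t" by (simp only: of_nat_le_iff)
  then have "(m - l) * (real N3 + z + d * b) \<le> (m - l) * t" using lm by (intro mult_left_mono) auto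
  moreover have "d * (m * length c - (m - l) * b) \<le> d * cwt c"
    using sum_list_two_levels[OF c(2) closed_walk_set[OF c(1)] fin lm, of C] cw
    unfolding b_def by (intro mult_left_mono) auto
  moreover have "real (t - z) = real t - z" using tz by (simp add: of_nat_diff)
  ultimately have "w \<le> w5" using w5(2) w3(4) w2(2) by (simp add: algebra_simps)
  then show ?thesis using w5(1) by blast
qed

lemma admissible_union:
  assumes "finite U" "finite Z" "U \<inter> Z = {}" "admissible U \<pi> \<mu>" "admissible Z \<rho> \<nu>"
  shows "admissible (U \<union> Z) (\<lambda>u. if u \<in> Z then \<rho> u else \<pi> u) (\<lambda>u. if u \<in> Z then \<nu> u else \<mu> u)"
proof -
  let ?\<pi> = "\<lambda>u. if u \<in> Z then \<rho> u else \<pi> u"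
  have U: "u \<notin> Z" if "u \<in> U" for u using that assms(3) by blast
  have "bij_betw ?\<pi> (U \<union> Z) (U \<union> Z)"
  proof (rule bij_betw_combine)
    show "bij_betw ?\<pi> U U" using assms(4) U unfolding admissible_def by (simp cong: bij_betw_cong)
    show "bij_betw ?\<pi> Z Z" using assms(5) unfolding admissible_def by (simp cong: bij_betw_cong)
  qed fact
  then show ?thesis
    using assms U unfolding admissible_def by (auto simp: sum.union_disjoint cong: sum.cong)
qed

lemma violates_cong:
  assumes "\<And>x. x \<in> set c \<Longrightarrow> \<pi> x = \<rho> x \<and> \<mu> x = \<nu> x"
  shows "violates \<pi> \<mu> c \<longleftrightarrow> violates \<rho> \<nu> c"
proof -
  have "map \<mu> c = map \<nu> c" using assms by simp
  moreover have "follows \<pi> c (hd c) \<longleftrightarrow> follows \<rho> c (hd c)" using assms by (intro follows_cong) blast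
  ultimately show ?thesis unfolding violates_def by presburger
qed

lemma walk_avoids_or_via:
  assumes "walk S xs j"
  shows "walk (S - Z) xs j \<or> via S Z (src xs j) j (length xs) (wt xs j)"
proof (cases "j \<in> Z")
  case True
  then have "via S Z (src xs j) j (length xs) (wt xs j)"
    unfolding via_def using assms walk_end[OF assms]
    by (intro exI[of _ xs] exI[of _ "[]"] exI[of _ j]) auto
  then show ?thesis ..
next
  case j: False
  show ?thesis
  proof (cases "\<exists>z\<in>set xs. z \<in> Z")
    case True
    then obtain z p q where z: "z \<in> Z" "xs = p @ z # q" by (metis split_list)
    then have "via S Z (src xs j) j (length xs) (wt xs j)"
      unfolding via_def using assms
      by (intro exI[of _ p] exI[of _ "z # q"] exI[of _ z]) auto
    then show ?thesis ..
  next
    case False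
    then have "walk (S - Z) xs j"
      using assms walk_set[OF assms] walk_end[OF assms] j by (intro walk_subset[OF assms]) auto
    then show ?thesis ..
  qed
qed

text \<open>The critical cycle of the smaller set is also a closed walk in the larger one. Hence the
  means do not increase as vertices are deleted.\<close>

lemma critical_mean_le:
  assumes "critical S Z l" "S \<subseteq> D" "mean_le D m"
  shows "l \<le> m"
proof -
  obtain zs where zs: "distinct zs" "set zs = Z" "closed_walk Z zs" "cwt zs = l * card Z"
    using assms(1) unfolding critical_def by blast
  have "closed_walk D zs" using closed_walk_mono[OF zs(3)] assms(1,2) unfolding critical_def by blast
  then have "l * card Z \<le> m * card Z"
    using assms(3) zs distinct_card[OF zs(1)] unfolding mean_le_def by metis
  then show ?thesis using critical_card_pos[OF assms(1)] by simp
qed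

text \<open>The cycle through \<open>u\<close> is \<open>Cy u\<close>; it was found to be critical when the vertex set \<open>D u\<close> remained.
  The set \<open>S\<close> is what remains at present.\<close>

definition selection where
  "selection N t S U D Cy \<pi> \<mu> \<longleftrightarrow> U \<subseteq> N \<and> S \<subseteq> N \<and>
    (\<forall>u\<in>U. u \<in> Cy u \<and> Cy u \<subseteq> U \<and> D u \<subseteq> N \<and> critical (D u) (Cy u) (\<mu> u) \<and> S \<subseteq> D u - Cy u \<and>
       (\<forall>v\<in>Cy u. D v = D u \<and> Cy v = Cy u \<and> \<mu> v = \<mu> u)) \<and>
    (\<forall>u\<in>U. \<forall>v\<in>U. v \<in> Cy u \<or> D v \<subseteq> D u - Cy u \<or> D u \<subseteq> D v - Cy v) \<and>
    admissible U \<pi> \<mu> \<and> strict U \<pi> \<mu> \<and>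
    (\<forall>xs j. walk N xs j \<and> length xs = t \<longrightarrow>
       walk S xs j \<or> (\<exists>u\<in>U. \<exists>w\<ge>wt xs j. via (D u) (Cy u) (src xs j) j t w))"

lemma selection_start: "selection N t N {} D Cy \<pi> \<mu>"
proof -
  have "\<not> closed_walk {} c" for c using closed_walk_set[of "{}" c] unfolding closed_walk_def by auto
  then show ?thesis unfolding selection_def admissible_def strict_def by (auto simp: bij_betw_def)
qed

text \<open>The certificate is strict on \<open>U\<close> and on \<open>Z\<close> alone, so a simple
  violating cycle \<open>c\<close> meets both. For the earliest kept cycle \<open>Cy q\<close> that
  \<open>c\<close> meets, all of \<open>c\<close> lies in \<open>D q\<close>, and
  \<open>via_dominated\<close> applies.\<close>

lemma violating_cycle_dominates:
  assumes fin: "finite N" and sel: "selection N t S U D Cy \<pi> \<mu>"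
    and crit: "critical S Z l" and Z: "strict Z \<rho> (\<lambda>_. l)"
    and ns: "\<not> strict (U \<union> Z) (\<lambda>u. if u \<in> Z then \<rho> u else \<pi> u) (\<lambda>u. if u \<in> Z then l else \<mu> u)"
    and t: "(card N - 1)\<^sup>2 + 1 \<le> t"
  obtains q where "q \<in> U" "\<And>i j w. via S Z i j t w \<Longrightarrow> \<exists>w'\<ge>w. via (D q) (Cy q) i j t w'"
proof -
  have U: "u \<in> Cy u" "Cy u \<subseteq> U" "D u \<subseteq> N" "critical (D u) (Cy u) (\<mu> u)" "S \<subseteq> D u - Cy u"
    "v \<in> Cy u \<Longrightarrow> D v = D u \<and> Cy v = Cy u \<and> \<mu> v = \<mu> u" if "u \<in> U" for u v
    using sel that unfolding selection_def by blast+
  have chain: "v \<in> Cy u \<or> D v \<subseteq> D u - Cy u \<or> D u \<subseteq> D v - Cy v" if "u \<in> U" "v \<in> U" for u v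
    using sel that unfolding selection_def by blast
  have strict: "strict U \<pi> \<mu>" using sel unfolding selection_def by blast
  have ZS: "Z \<subseteq> S" using crit unfolding critical_def by blast
  have CD: "Cy u \<subseteq> D u" if "u \<in> U" for u using U(4)[OF that] unfolding critical_def by blast
  have disj: "u \<notin> Z" if "u \<in> U" for u using U(1,5)[OF that] ZS by blast
  let ?\<pi> = "\<lambda>u. if u \<in> Z then \<rho> u else \<pi> u" and ?\<mu> = "\<lambda>u. if u \<in> Z then l else \<mu> u"
  obtain c where c: "closed_walk (U \<union> Z) c" "violates ?\<pi> ?\<mu> c" "distinct c"
    by (rule violating_cycle[OF ns])
  have cU: "set c \<subseteq> U \<union> Z" using closed_walk_set[OF c(1)] .
  have cZ: "set c \<inter> Z \<noteq> {}"
  proof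
    assume e: "set c \<inter> Z = {}"
    then have "closed_walk U c" using closed_walk_subset[OF c(1)] cU by blast
    moreover have "violates ?\<pi> ?\<mu> c \<longleftrightarrow> violates \<pi> \<mu> c" by (rule violates_cong) (use e in auto)
    ultimately show False using strict c(2) unfolding strict_iff by blast
  qed
  have "set c \<inter> U \<noteq> {}"
  proof
    assume e: "set c \<inter> U = {}"
    then have s: "set c \<subseteq> Z" using cU by blast
    then have "closed_walk Z c" using closed_walk_subset[OF c(1)] by blast
    moreover have "violates ?\<pi> ?\<mu> c \<longleftrightarrow> violates \<rho> (\<lambda>_. l) c"
      by (rule violates_cong) (use s in auto)
    ultimately show False using Z c(2) unfolding strict_iff by blast
  qed
  moreover have "finite (set c \<inter> U)" by simp
  \<comment> \<open>The sets \<open>D v\<close> shrink during the selection, so the largest one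
    belongs to the earliest cycle.\<close>
  ultimately obtain q where q: "q \<in> set c" "q \<in> U" and
    max: "\<And>v. v \<in> set c \<Longrightarrow> v \<in> U \<Longrightarrow> card (D v) \<le> card (D q)"
    using obtains_MAX[of "set c \<inter> U" "\<lambda>u. card (D u)"] Max_ge
    by (metis (no_types, lifting) IntD1 IntD2 IntI finite_imageI imageI)
  have inD: "v \<in> D q" if v: "v \<in> set c" "v \<in> U" for v
    using chain[OF q(2) v(2)]
  proof (elim disjE)
    assume "v \<in> Cy q"
    then show ?thesis using CD[OF q(2)] by blast
  next
    assume "D v \<subseteq> D q - Cy q"
    then show ?thesis using U(1)[OF v(2)] CD[OF v(2)] by blast
  next
    assume a: "D q \<subseteq> D v - Cy v"
    then have "D q \<subset> D v" using U(1)[OF v(2)] CD[OF v(2)] by blast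
    then have "card (D q) < card (D v)"
      using U(3)[OF v(2)] fin finite_subset psubset_card_mono by metis
    then show ?thesis using max[OF v] by simp
  qed
  have SD: "S \<subseteq> D q - Cy q" using U(5)[OF q(2)] .
  have cD: "closed_walk (D q) c"
    using closed_walk_subset[OF c(1)] cU inD SD ZS by blast
  have le: "l \<le> \<mu> v" if "v \<in> U" for v
    using critical_mean_le[OF crit] U(4,5)[OF that] unfolding critical_def by blast
  \<comment> \<open>All kept means are at least \<open>l\<close>, so they may be lowered to
    \<open>l\<close> off \<open>Cy q\<close>; the weight of \<open>c\<close> still reaches the
    sum.\<close>
  have "sum_list (map (\<lambda>x. if x \<in> Cy q then \<mu> q else l) c) \<le> sum_list (map ?\<mu> c)"
  proof (rule sum_list_mono)
    fix x assume "x \<in> set c"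
    then consider "x \<in> Z" "x \<notin> Cy q" | "x \<in> U" "x \<notin> Z" using cU disj ZS SD by blast
    then show "(if x \<in> Cy q then \<mu> q else l) \<le> ?\<mu> x"
      using U(6)[OF q(2), of x] le[of x] by cases auto
  qed
  also have "\<dots> \<le> cwt c" using c(2) unfolding violates_def by argo
  finally have cw: "sum_list (map (\<lambda>x. if x \<in> Cy q then \<mu> q else l) c) \<le> cwt c" .
  have finD: "finite (D q)" and card: "card (D q) \<le> card N"
    using U(3)[OF q(2)] fin finite_subset card_mono by metis+
  have "set c \<inter> Cy q \<noteq> {}" using q U(1)[OF q(2)] by blast
  then show ?thesis
    using that[OF q(2)] via_dominated[OF finD U(4)[OF q(2)] crit SD le[OF q(2)] cD c(3) _ cZ cw _ card t]
    by blast
qed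

text \<open>\<open>Z\<close> leaves \<open>S\<close> in either case, which ensures termination. If
  the certificate extends to \<open>U \<union> Z\<close>, the walks through \<open>Z\<close> form a
  new class; otherwise they are handed over to the class of a kept cycle.\<close>

lemma selection_step:
  assumes fin: "finite N" and sel: "selection N t S U D Cy \<pi> \<mu>" and t: "(card N - 1)\<^sup>2 + 1 \<le> t"
    and c0: "closed_walk S c0"
  shows "\<exists>S' U' D' Cy' \<pi>' \<mu>'. card S' < card S \<and> selection N t S' U' D' Cy' \<pi>' \<mu>'"
proof -
  have SN: "S \<subseteq> N" and UN: "U \<subseteq> N" using sel unfolding selection_def by blast+
  have finS: "finite S" and finU: "finite U" using fin SN UN finite_subset by blast+
  obtain l Z \<rho> where Z: "critical S Z l" "admissible Z \<rho> (\<lambda>_. l)" "strict Z \<rho> (\<lambda>_. l)"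
    by (rule critical_exists[OF finS c0])
  have ZS: "Z \<subseteq> S" using Z(1) unfolding critical_def by blast
  have finZ: "finite Z" using ZS finS finite_subset by blast
  have "card (S - Z) < card S"
    using critical_card_pos[OF Z(1)] ZS finS
    by (metis Diff_subset card_gt_0_iff double_diff Diff_empty psubsetI psubset_card_mono order_refl Diff_cancel)
  moreover have "\<exists>U' D' Cy' \<pi>' \<mu>'. selection N t (S - Z) U' D' Cy' \<pi>' \<mu>'"
  proof (cases "strict (U \<union> Z) (\<lambda>u. if u \<in> Z then \<rho> u else \<pi> u) (\<lambda>u. if u \<in> Z then l else \<mu> u)")
    case False
    obtain q where q: "q \<in> U" "\<And>i j w. via S Z i j t w \<Longrightarrow> \<exists>w'\<ge>w. via (D q) (Cy q) i j t w'"
      by (rule violating_cycle_dominates[OF fin sel Z(1,3) False t]) blast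
    have "selection N t (S - Z) U D Cy \<pi> \<mu>"
      unfolding selection_def
    proof (intro conjI allI impI)
      fix xs j assume x: "walk N xs j \<and> length xs = t"
      then have "walk S xs j \<or> (\<exists>u\<in>U. \<exists>w\<ge>wt xs j. via (D u) (Cy u) (src xs j) j t w)"
        using sel unfolding selection_def by blast
      then show "walk (S - Z) xs j \<or> (\<exists>u\<in>U. \<exists>w\<ge>wt xs j. via (D u) (Cy u) (src xs j) j t w)"
        using walk_avoids_or_via[of S xs j Z] q x by blast
    qed (use sel in \<open>unfold selection_def, blast\<close>)+
    then show ?thesis by blast
  next
    case True
    have disj: "u \<notin> Z" if "u \<in> U" for u using sel that ZS unfolding selection_def by blast
    have U: "u \<in> Cy u" "Cy u \<subseteq> U" "D u \<subseteq> N" "critical (D u) (Cy u) (\<mu> u)" "S \<subseteq> D u - Cy u"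
      "v \<in> Cy u \<Longrightarrow> D v = D u \<and> Cy v = Cy u \<and> \<mu> v = \<mu> u" if "u \<in> U" for u v
      using sel that unfolding selection_def by blast+
    have chain: "v \<in> Cy u \<or> D v \<subseteq> D u - Cy u \<or> D u \<subseteq> D v - Cy v" if "u \<in> U" "v \<in> U" for u v
      using sel that unfolding selection_def by blast
    have nZ: "v \<notin> Z" if "u \<in> U" "v \<in> Cy u" for u v using U(2)[OF that(1)] that(2) disj by blast
    let ?D = "\<lambda>u. if u \<in> Z then S else D u" and ?Cy = "\<lambda>u. if u \<in> Z then Z else Cy u"
      and ?\<mu> = "\<lambda>u. if u \<in> Z then l else \<mu> u"
    have "selection N t (S - Z) (U \<union> Z) ?D ?Cy (\<lambda>u. if u \<in> Z then \<rho> u else \<pi> u) ?\<mu>"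
      unfolding selection_def
    proof (intro conjI)
      show "U \<union> Z \<subseteq> N" "S - Z \<subseteq> N" using UN SN ZS by blast+
      show "strict (U \<union> Z) (\<lambda>u. if u \<in> Z then \<rho> u else \<pi> u) ?\<mu>" by fact
      show "admissible (U \<union> Z) (\<lambda>u. if u \<in> Z then \<rho> u else \<pi> u) ?\<mu>"
        by (rule admissible_union[OF finU finZ]) (use disj sel Z in \<open>auto simp: selection_def\<close>)
      show "\<forall>u\<in>U \<union> Z. u \<in> ?Cy u \<and> ?Cy u \<subseteq> U \<union> Z \<and> ?D u \<subseteq> N \<and> critical (?D u) (?Cy u) (?\<mu> u) \<and>
        S - Z \<subseteq> ?D u - ?Cy u \<and> (\<forall>v\<in>?Cy u. ?D v = ?D u \<and> ?Cy v = ?Cy u \<and> ?\<mu> v = ?\<mu> u)"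
      proof
        fix u assume "u \<in> U \<union> Z"
        then consider "u \<in> Z" | "u \<in> U" "u \<notin> Z" by blast
        then show "u \<in> ?Cy u \<and> ?Cy u \<subseteq> U \<union> Z \<and> ?D u \<subseteq> N \<and> critical (?D u) (?Cy u) (?\<mu> u) \<and>
          S - Z \<subseteq> ?D u - ?Cy u \<and> (\<forall>v\<in>?Cy u. ?D v = ?D u \<and> ?Cy v = ?Cy u \<and> ?\<mu> v = ?\<mu> u)"
        proof cases
          case 1
          then show ?thesis using SN Z(1) by simp
        next
          case 2
          have "?D v = D u \<and> ?Cy v = Cy u \<and> ?\<mu> v = \<mu> u" if "v \<in> Cy u" for v
            using nZ[OF 2(1) that] U(6)[OF 2(1) that] by (simp only: if_False simp_thms)
          moreover have "S - Z \<subseteq> D u - Cy u" "Cy u \<subseteq> U \<union> Z" using U(2,5)[OF 2(1)] by blast+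
          ultimately show ?thesis
            using U(1,3,4)[OF 2(1)] unfolding if_not_P[OF 2(2)] by blast
        qed
      qed
      show "\<forall>u\<in>U \<union> Z. \<forall>v\<in>U \<union> Z. v \<in> ?Cy u \<or> ?D v \<subseteq> ?D u - ?Cy u \<or> ?D u \<subseteq> ?D v - ?Cy v"
      proof (intro ballI)
        fix u v assume uv: "u \<in> U \<union> Z" "v \<in> U \<union> Z"
        show "v \<in> ?Cy u \<or> ?D v \<subseteq> ?D u - ?Cy u \<or> ?D u \<subseteq> ?D v - ?Cy v"
          using uv disj chain[of u v] U(5)[of u] U(5)[of v] by auto
      qed
      show "\<forall>xs j. walk N xs j \<and> length xs = t \<longrightarrow> walk (S - Z) xs j \<or>
        (\<exists>u\<in>U \<union> Z. \<exists>w\<ge>wt xs j. via (?D u) (?Cy u) (src xs j) j t w)"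
      proof (intro allI impI)
        fix xs j assume x: "walk N xs j \<and> length xs = t"
        then consider "walk S xs j" | u w where "u \<in> U" "w \<ge> wt xs j" "via (D u) (Cy u) (src xs j) j t w"
          using sel unfolding selection_def by blast
        then show "walk (S - Z) xs j \<or> (\<exists>u\<in>U \<union> Z. \<exists>w\<ge>wt xs j. via (?D u) (?Cy u) (src xs j) j t w)"
        proof cases
          case 1
          show ?thesis
          proof (cases "walk (S - Z) xs j")
            case False
            then have v: "via S Z (src xs j) j t (wt xs j)" using walk_avoids_or_via[OF 1] x by blast
            obtain z where "z \<in> Z" using v unfolding via_def by blast
            then show ?thesis using v by (intro disjI2 bexI[of _ z] exI[of _ "wt xs j"]) auto
          qed simp
        next
          case 2
          then show ?thesis using disj by (intro disjI2 bexI[of _ u] exI[of _ w]) auto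
        qed
      qed
    qed
    then show ?thesis by blast
  qed
  ultimately show ?thesis by blast
qed

text \<open>Once \<open>S\<close> contains no closed walk, it contains no walk of length
  \<open>t\<close>, since \<open>card S \<le> t\<close> would force a repeated vertex. All walks of
  length \<open>t\<close> are then classified, and \<open>S\<close> may be replaced by the empty
  set.\<close>

lemma selection_complete:
  assumes fin: "finite N" and N: "card N > 0" and t: "(card N - 1)\<^sup>2 + 1 \<le> t"
  obtains U D Cy \<pi> \<mu> where "selection N t {} U D Cy \<pi> \<mu>"
proof -
  have step: "\<exists>S' U' D' Cy' \<pi>' \<mu>'. selection N t S' U' D' Cy' \<pi>' \<mu>' \<and> (\<nexists>c. closed_walk S' c)"
    if "selection N t S U D Cy \<pi> \<mu>" for S U D Cy \<pi> \<mu>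
    using that
  proof (induction "card S" arbitrary: S U D Cy \<pi> \<mu> rule: less_induct)
    case less
    show ?case
    proof (cases "\<exists>c. closed_walk S c")
      case True
      then obtain c where "closed_walk S c" ..
      from selection_step[OF fin less.prems t this] obtain S' U' D' Cy' \<pi>' \<mu>' where
        s: "card S' < card S" "selection N t S' U' D' Cy' \<pi>' \<mu>'" by blast
      show ?thesis by (rule less.hyps[OF s])
    qed (use less.prems in blast)
  qed
  obtain S U D Cy \<pi> \<mu> where s: "selection N t S U D Cy \<pi> \<mu>" "\<nexists>c. closed_walk S c"
    using step[OF selection_start] by blast
  have SN: "S \<subseteq> N" using s(1) unfolding selection_def by blast
  have "card N - 1 \<le> (card N - 1)\<^sup>2" unfolding power2_eq_square by (rule le_square)
  then have "card S \<le> t" using t N card_mono[OF fin SN] by linarith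
  then have no: "\<not> walk S xs j" if "length xs = t" for xs j
    using that s(2) finite_subset[OF SN fin] walk_repeat[of S xs j]
    by (metis closed_walkI list.discI src.simps(2))
  have "selection N t {} U D Cy \<pi> \<mu>"
    unfolding selection_def
  proof (intro conjI allI impI)
    fix xs j assume "walk N xs j \<and> length xs = t"
    then show "walk {} xs j \<or> (\<exists>u\<in>U. \<exists>w\<ge>wt xs j. via (D u) (Cy u) (src xs j) j t w)"
      using s(1) no unfolding selection_def by blast
  qed (use s(1) in \<open>unfold selection_def, blast\<close>)+
  then show ?thesis using that by blast
qed

section \<open>Cutting walks at a fixed length\<close>

text \<open>A factorization needs halves whose lengths do not depend on the walk. The cut is moved
  along \<open>Z\<close> until the first length is a multiple of \<open>d\<close>, and the halves
  are filled up with turns of \<open>Z\<close>, \<open>2 * Suc t\<close> in all.\<close>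

lemma via_aligned:
  assumes crit: "critical S Z l" and v: "via S Z i j t w"
  defines "d \<equiv> card Z"
  shows "\<exists>u\<in>Z. \<exists>xs ys. walk S xs u \<and> src xs u = i \<and> length xs = Suc t * d \<and>
    walk S ys j \<and> src ys j = u \<and> length ys = Suc t * d + t \<and> wt xs u + wt ys j = w + 2 * l * (Suc t * d)"
proof -
  have d: "d > 0" unfolding d_def using critical_card_pos[OF crit] .
  have ZS: "Z \<subseteq> S" using crit unfolding critical_def by blast
  obtain xs ys k where v: "k \<in> Z" "walk S xs k" "src xs k = i" "walk S ys j" "src ys j = k"
     "t = length xs + length ys" "w = wt xs k + wt ys j"
    using v unfolding via_def by blast
  obtain zs where zs: "set zs = Z" "walk Z zs k" "src zs k = k" "length zs = card Z"
    "wt zs k = l * card Z" by (rule critical_at[OF crit v(1)])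
  \<comment> \<open>\<open>f * d\<close> is \<open>length xs\<close> rounded up to a multiple of
    \<open>d\<close>, and \<open>e\<close> is the number of steps along the cycle from
    \<open>k\<close> to the new cut \<open>u\<close>.\<close>
  define f where "f = (length xs + d - 1) div d"
  define e where "e = f * d - length xs"
  have f: "length xs \<le> f * d" "f * d < length xs + d"
  proof -
    have "(length xs + d - 1) mod d < d" using d by simp
    then show "length xs \<le> f * d" "f * d < length xs + d"
      using div_mult_mod_eq[of "length xs + d - 1" d] d unfolding f_def by linarith+
  qed
  have e: "e < d" "length xs + e = f * d" using f unfolding e_def by linarith+
  have "f \<le> Suc t"
  proof (rule ccontr)
    assume "\<not> f \<le> Suc t"
    then have "(t + 2) * d \<le> f * d" by (intro mult_le_mono1) simp
    moreover have "t \<le> t * d" using d by simp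
    ultimately show False using f(2) v(6) d by (simp add: algebra_simps)
  qed
  define as bs u where "as = take e zs" and "bs = drop (Suc e) zs" and "u = zs ! e"
  have ab: "zs = as @ u # bs"
    unfolding as_def bs_def u_def using e(1) zs(4) d_def by (intro id_take_nth_drop) simp
  have las: "length as = e" unfolding as_def using e(1) zs(4) d_def by simp
  have lbs: "e + 1 + length bs = d" using zs(4) las unfolding ab d_def by simp
  have u: "u \<in> Z" using zs(1) ab by auto
  obtain c where c: "walk Z c u" "src c u = u" "length c = card Z" "wt c u = l * card Z"
    by (rule critical_at[OF crit u])
  have cS: "walk S c u" using walk_mono[OF c(1) ZS] .
  define r where "r = (\<lambda>x. concat (replicate x c))"
  have r: "walk S (r x) u" "src (r x) u = u" "wt (r x) u = x * (l * d)" "length (r x) = x * d" for x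
    using walk_concat_replicate[OF cS c(2), of x] c(3,4) unfolding r_def d_def
    by (auto simp: length_concat sum_list_replicate)
  have zS: "walk S as u" "walk S (u # bs) k" using walk_mono[OF zs(2) ZS] unfolding ab by auto
  have sa: "src as u = k" using zs(3) unfolding ab by simp
  have wz: "wt as u + wt (u # bs) k = l * d" using zs(5) unfolding ab d_def by simp
  let ?x = "xs @ as @ r (Suc t - f)" and ?y = "r (t + f) @ (u # bs) @ ys"
  have "Suc t - f + f = Suc t" using \<open>f \<le> Suc t\<close> by simp
  then have lx: "(Suc t - f) * d + f * d = Suc t * d" by (metis add_mult_distrib)
  show ?thesis
  proof (intro bexI[OF _ u] exI conjI)
    show "walk S ?x u" "src ?x u = i" using v r zS sa by auto
    show "walk S ?y j" "src ?y j = u" using v r zS by auto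
    show "length ?x = Suc t * d" using lx e(2) las r(4) by simp
    show "length ?y = Suc t * d + t" using lbs e(2) v(6) r(4) by (simp add: algebra_simps)
    have "real (Suc t - f) = real (Suc t) - real f" using \<open>f \<le> Suc t\<close> by (simp add: of_nat_diff)
    then show "wt ?x u + wt ?y j = w + 2 * l * (Suc t * d)"
      using v(5,7) r wz sa by (simp add: algebra_simps)
  qed
qed

end

section \<open>Max-plus matrices\<close>

lemma trop_add_le_iff [simp]: "x + y \<le> (z :: trop) \<longleftrightarrow> x \<le> z \<and> y \<le> z"
  by (simp add: plus_trop_def)

lemma trop_le_sum: "finite X \<Longrightarrow> x \<in> X \<Longrightarrow> f x \<le> (\<Sum>x\<in>X. f x :: trop)"
  by (induction X rule: finite_induct) (auto simp: plus_trop_def le_max_iff_disj)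

lemma trop_sum_le: "finite X \<Longrightarrow> (\<And>x. x \<in> X \<Longrightarrow> f x \<le> y) \<Longrightarrow> (\<Sum>x\<in>X. f x) \<le> (y :: trop)"
  by (induction X rule: finite_induct) (auto simp: zero_trop_def)

lemma trop_sum_attained:
  "finite X \<Longrightarrow> (\<Sum>x\<in>X. f x) \<noteq> NegInf \<Longrightarrow> \<exists>x\<in>X. (\<Sum>x\<in>X. f x) = (f x :: trop)"
  by (induction X rule: finite_induct) (auto simp: zero_trop_def plus_trop_def max_def)

lemma trop_times_eq_NegInf_iff [simp]: "x * y = NegInf \<longleftrightarrow> x = NegInf \<or> y = NegInf"
  by (cases x; cases y) auto

lemma trop_le_NegInf_iff [simp]: "x \<le> NegInf \<longleftrightarrow> x = NegInf"
  by (cases x) auto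

lemma trop_mult_mono: "x \<le> y \<Longrightarrow> x' \<le> y' \<Longrightarrow> x * x' \<le> y * (y' :: trop)"
  by (cases x; cases y; cases x'; cases y') auto

text \<open>The value at \<open>NegInf\<close> is a default: the edges of the digraph will be the
  finite entries, so it never enters the weight of a walk.\<close>

primrec trop_val :: "trop \<Rightarrow> real" where
  "trop_val NegInf = 0"
| "trop_val (Fin x) = x"

lemma Fin_trop_val: "x \<noteq> NegInf \<Longrightarrow> Fin (trop_val x) = x"
  by (cases x) auto

lemma trop_prod:
  "finite X \<Longrightarrow> (\<Prod>x\<in>X. f x) =
     (if \<forall>x\<in>X. f x \<noteq> NegInf then Fin (\<Sum>x\<in>X. trop_val (f x)) else NegInf)"
proof (induction X rule: finite_induct)
  case (insert x X)
  then show ?case by (cases "f x") auto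
qed (simp add: one_trop_def)

lemma factor_rank_le:
  "P \<in> carrier_mat (dim_row C) k \<Longrightarrow> Q \<in> carrier_mat k (dim_col C) \<Longrightarrow> C = P * Q \<Longrightarrow> factor_rank C \<le> k"
  unfolding factor_rank_def by (rule Least_le) blast

section \<open>Walks and powers of a matrix\<close>

locale trop_matrix =
  fixes A :: "trop mat" and n :: nat
  assumes A: "A \<in> carrier_mat n n"

sublocale trop_matrix \<subseteq> weighted_digraph "\<lambda>i j. A $$ (i, j) \<noteq> NegInf" "\<lambda>i j. trop_val (A $$ (i, j))" .

context trop_matrix begin

text \<open>The restriction to \<open>S\<close> keeps the size \<open>n\<close>, so vertices need no
  renumbering.\<close>

definition induced :: "nat set \<Rightarrow> trop mat" where
  "induced S = mat n n (\<lambda>(i, j). if i \<in> S \<and> j \<in> S then A $$ (i, j) else NegInf)"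

lemma induced_all: "induced {..<n} = A"
  using A by (intro eq_matI) (auto simp: induced_def)

lemma induced_pow_Suc:
  assumes "i < n" "j < n"
  shows "(induced S ^\<^sub>m Suc L) $$ (i, j) = (\<Sum>k<n. (induced S ^\<^sub>m L) $$ (i, k) * induced S $$ (k, j))"
proof -
  have "dim_row (induced S) = n" "dim_col (induced S) = n" unfolding induced_def by auto
  then show ?thesis
    using assms by (auto simp: scalar_prod_def atLeast0LessThan intro!: sum.cong)
qed

lemma walk_le_pow:
  assumes "S \<subseteq> {..<n}" "walk S xs j"
  shows "Fin (wt xs j) \<le> (induced S ^\<^sub>m length xs) $$ (src xs j, j)"
  using assms(2)
proof (induction xs arbitrary: j rule: rev_induct)
  case Nil
  then show ?case using assms(1) by (auto simp: one_trop_def induced_def)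
next
  case (snoc k xs)
  have w: "walk S xs k" "A $$ (k, j) \<noteq> NegInf" "k \<in> S" "j \<in> S" using snoc.prems by auto
  have src: "src xs k < n" using walk_src[OF w(1)] assms(1) by auto
  have kj: "k < n" "j < n" using w assms(1) by auto
  have "Fin (wt (xs @ [k]) j) = Fin (wt xs k) * Fin (trop_val (A $$ (k, j)))" by simp
  also have "\<dots> \<le> (induced S ^\<^sub>m length xs) $$ (src xs k, k) * induced S $$ (k, j)"
    using snoc.IH[OF w(1)] w kj by (intro trop_mult_mono) (auto simp: induced_def Fin_trop_val)
  also have "\<dots> \<le> (induced S ^\<^sub>m Suc (length xs)) $$ (src xs k, j)"
    unfolding induced_pow_Suc[OF src kj(2)]
    using kj by (intro trop_le_sum) auto
  finally show ?case by simp
qed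

text \<open>The condition on \<open>i\<close> and \<open>j\<close> concerns \<open>L = 0\<close>:
  the identity matrix has finite diagonal entries also at vertices outside \<open>S\<close>, where
  no walk in \<open>S\<close> ends.\<close>

lemma pow_walk:
  assumes "i < n" "j < n" "i \<in> S \<or> j \<in> S" "(induced S ^\<^sub>m L) $$ (i, j) \<noteq> NegInf"
  shows "\<exists>xs. walk S xs j \<and> src xs j = i \<and> length xs = L \<and> (induced S ^\<^sub>m L) $$ (i, j) = Fin (wt xs j)"
  using assms(2-4)
proof (induction L arbitrary: j)
  case 0
  then have "i = j" using assms(1) by (auto simp: induced_def zero_trop_def split: if_splits)
  then show ?case using 0 by (intro exI[of _ "[]"]) (auto simp: induced_def one_trop_def)
next
  case (Suc L)
  obtain k where k: "k < n" "(induced S ^\<^sub>m Suc L) $$ (i, j) = (induced S ^\<^sub>m L) $$ (i, k) * induced S $$ (k, j)"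
    using trop_sum_attained[of "{..<n}"] Suc.prems(3)
    unfolding induced_pow_Suc[OF assms(1) Suc.prems(1)] by blast
  have ne: "(induced S ^\<^sub>m L) $$ (i, k) \<noteq> NegInf" "induced S $$ (k, j) \<noteq> NegInf"
    using Suc.prems(3) unfolding k(2) by auto
  then have kj: "k \<in> S" "j \<in> S" "A $$ (k, j) \<noteq> NegInf" "induced S $$ (k, j) = A $$ (k, j)"
    using k(1) Suc.prems(1) unfolding induced_def by (auto split: if_splits)
  obtain xs where xs: "walk S xs k" "src xs k = i" "length xs = L"
    "(induced S ^\<^sub>m L) $$ (i, k) = Fin (wt xs k)"
    using Suc.IH[OF k(1) _ ne(1)] kj(1) by blast
  have "(induced S ^\<^sub>m Suc L) $$ (i, j) = Fin (wt xs k) * Fin (trop_val (A $$ (k, j)))"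
    unfolding k(2) xs(4) kj(4) Fin_trop_val[OF kj(3)] ..
  then show ?case using xs kj by (intro exI[of _ "xs @ [k]"]) auto
qed

section \<open>The tropical rank bounds the number of kept vertices\<close>

text \<open>The enumeration \<open>pick U\<close> carries permutations of \<open>{..<k}\<close> to
  permutations of \<open>U\<close> of the same weight. There \<open>strict_permutes\<close> bounds
  every finite weight by the sum of \<open>\<mu>\<close> and leaves \<open>\<pi>\<close> as the only
  candidate for equality.\<close>

lemma submatrix_nonsingular:
  assumes UN: "U \<subseteq> {..<n}" and adm: "admissible U \<pi> \<mu>" and strict: "strict U \<pi> \<mu>"
  shows "trop_nonsingular (submatrix A U U)"
proof -
  define k where "k = card U"
  define f where "f = pick U"
  define B where "B = submatrix A U U"
  have finU: "finite U" using UN finite_subset by blast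
  have U: "{i. i < n \<and> i \<in> U} = U" using UN by auto
  have dim: "dim_row B = k" "dim_col B = k" unfolding B_def k_def using A U by (auto simp: dim_submatrix)
  have entry: "B $$ (i, j) = A $$ (f i, f j)" if "i < k" "j < k" for i j
    unfolding B_def f_def using that A U k_def by (intro submatrix_index) auto
  have inj: "inj_on f {..<k}"
    unfolding f_def k_def inj_on_def by (metis lessThan_iff less_irrefl linorder_neqE_nat pick_mono_le)
  moreover have "f ` {..<k} \<subseteq> U" unfolding f_def k_def using pick_in_set_le by auto
  ultimately have bij: "bij_betw f {..<k} U"
    unfolding bij_betw_def using card_subset_eq[OF finU] k_def by (metis card_image card_lessThan)
  have fU: "f i \<in> U" if "i < k" for i using bij that unfolding bij_betw_def by auto
  define T where "T = (\<lambda>\<rho> u. if u \<in> U then f (\<rho> (inv_into {..<k} f u)) else u)"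
  have T: "T \<rho> permutes U" if "\<rho> permutes {..<k}" for \<rho>
    unfolding T_def by (rule permutes_bij_inv_into[OF that bij])
  have Tf: "T \<rho> (f i) = f (\<rho> i)" if "i < k" for \<rho> i
    unfolding T_def using fU[OF that] inj that by simp
  have weight: "trop_weight B \<rho> = (if \<forall>u\<in>U. A $$ (u, T \<rho> u) \<noteq> NegInf
      then Fin (\<Sum>u\<in>U. trop_val (A $$ (u, T \<rho> u))) else NegInf)" if \<rho>: "\<rho> permutes {..<k}" for \<rho>
  proof -
    have "trop_weight B \<rho> = (\<Prod>i<k. A $$ (f i, T \<rho> (f i)))"
      unfolding trop_weight_def dim
    proof (rule prod.cong)
      fix i assume "i \<in> {..<k}"
      then have "i < k" "\<rho> i < k" using permutes_in_image[OF \<rho>, of i] by auto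
      then show "B $$ (i, \<rho> i) = A $$ (f i, T \<rho> (f i))" by (simp add: entry Tf)
    qed simp
    also have "\<dots> = (\<Prod>u\<in>U. A $$ (u, T \<rho> u))" by (rule prod.reindex_bij_betw[OF bij])
    finally show ?thesis using trop_prod[OF finU] by simp
  qed
  let ?m = "Fin (\<Sum>u\<in>U. \<mu> u)"
  have le: "trop_weight B \<rho> \<le> ?m" if \<rho>: "\<rho> permutes {..<k}" for \<rho>
    unfolding weight[OF \<rho>] using strict_permutes(1)[OF finU T[OF \<rho>] _ strict] by auto
  have eq: "\<rho> i = inv_into {..<k} f (\<pi> (f i))"
    if \<rho>: "\<rho> permutes {..<k}" "trop_weight B \<rho> = ?m" and i: "i < k" for \<rho> i
  proof -
    have "T \<rho> (f i) = \<pi> (f i)"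
      using strict_permutes(2)[OF finU T[OF \<rho>(1)] _ strict _ fU[OF i]] \<rho>(2)
      unfolding weight[OF \<rho>(1)] by (auto split: if_splits)
    then have "f (\<rho> i) = \<pi> (f i)" using Tf[OF i] by simp
    moreover have "\<rho> i \<in> {..<k}" using permutes_in_image[OF \<rho>(1)] i by auto
    ultimately show ?thesis using inj by (metis inv_into_f_f)
  qed
  \<comment> \<open>The pullback of \<open>\<pi>\<close> along the enumeration, which attains the
    bound.\<close>
  define \<rho>\<^sub>0 where "\<rho>\<^sub>0 = (\<lambda>i. if i \<in> {..<k} then inv_into {..<k} f (\<pi> (f i)) else i)"
  have \<pi>: "bij_betw \<pi> U U" using adm unfolding admissible_def by blast
  have "bij_betw (inv_into {..<k} f \<circ> (\<pi> \<circ> f)) {..<k} {..<k}"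
    using bij_betw_trans[OF bij_betw_trans[OF bij \<pi>] bij_betw_inv_into[OF bij]] .
  then have "bij_betw \<rho>\<^sub>0 {..<k} {..<k}"
    by (rule bij_betw_cong[THEN iffD1, rotated]) (simp add: \<rho>\<^sub>0_def)
  then have perm0: "\<rho>\<^sub>0 permutes {..<k}" by (rule bij_imp_permutes) (simp add: \<rho>\<^sub>0_def)
  have T0: "T \<rho>\<^sub>0 u = \<pi> u" if "u \<in> U" for u
  proof -
    have "u \<in> f ` {..<k}" using bij that unfolding bij_betw_def by blast
    then obtain i where i: "i < k" "u = f i" by blast
    have "\<pi> u \<in> f ` {..<k}" using \<pi> bij that unfolding bij_betw_def by blast
    then show ?thesis using Tf[OF i(1), of \<rho>\<^sub>0] i by (simp add: \<rho>\<^sub>0_def f_inv_into_f)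
  qed
  have w0: "trop_weight B \<rho>\<^sub>0 = ?m"
    unfolding weight[OF perm0] using adm T0 by (simp add: admissible_def)
  have per: "trop_per B = ?m"
    unfolding trop_per_def dim
  proof (rule Max_eqI)
    show "finite (trop_weight B ` {\<pi>. \<pi> permutes {..<k}})" by (simp add: finite_permutations)
  qed (use le w0 perm0 in \<open>auto intro!: image_eqI[of _ _ \<rho>\<^sub>0]\<close>)
  have "\<rho> = \<rho>\<^sub>0" if "\<rho> permutes {..<k}" "trop_weight B \<rho> = ?m" for \<rho>
  proof
    fix i show "\<rho> i = \<rho>\<^sub>0 i"
      using eq[OF that] permutes_not_in[OF that(1)] by (cases "i < k") (auto simp: \<rho>\<^sub>0_def)
  qed
  then show ?thesis
    unfolding B_def[symmetric] trop_nonsingular_def dim per using w0 perm0 dim by auto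
qed

lemma card_le_tropical_rank:
  assumes "U \<subseteq> {..<n}" "admissible U \<pi> \<mu>" "strict U \<pi> \<mu>"
  shows "card U \<le> tropical_rank A"
  unfolding tropical_rank_def using assms A submatrix_nonsingular[OF assms]
  by (intro Max_ge finite_tropical_rank_set) auto

text \<open>The bound on \<open>t\<close> is too small for a cycle of length \<open>n\<close>, whence \<open>card U < n\<close>; if \<open>card U = n\<close> then the
  tropical rank is \<open>n\<close>.\<close>

lemma factor_rank_pow_le_selection:
  assumes sel: "selection {..<n} t {} U D Cy \<pi> \<mu>" and small: "card U < n" and t: "(n - 1)\<^sup>2 + 1 \<le> t"
  shows "factor_rank (A ^\<^sub>m t) \<le> card U"
proof -
  have U: "u \<in> Cy u" "Cy u \<subseteq> U" "D u \<subseteq> {..<n}" "critical (D u) (Cy u) (\<mu> u)"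
    "v \<in> Cy u \<Longrightarrow> D v = D u \<and> Cy v = Cy u \<and> \<mu> v = \<mu> u" if "u \<in> U" for u v
    using sel that unfolding selection_def by blast+
  have UN: "U \<subseteq> {..<n}" using sel unfolding selection_def by blast
  then have finU: "finite U" using finite_subset by blast
  obtain f where f: "bij_betw f {..<card U} U"
    using ex_bij_betw_nat_finite[OF finU] unfolding atLeast0LessThan by blast
  \<comment> \<open>\<open>N u\<close> is the cut length of \<open>via_aligned\<close>. The added
    turns weigh \<open>2 * \<mu> u * N u\<close>; each factor takes back one half of this.\<close>
  define N where "N = (\<lambda>u. Suc t * card (Cy u))"
  define p where "p = (\<lambda>i u. (induced (D u) ^\<^sub>m N u) $$ (i, u) * Fin (- (\<mu> u * N u)))"
  define q where "q = (\<lambda>u j. (induced (D u) ^\<^sub>m (N u + t)) $$ (u, j) * Fin (- (\<mu> u * N u)))"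
  define P where "P = mat n (card U) (\<lambda>(i, x). p i (f x))"
  define Q where "Q = mat (card U) n (\<lambda>(x, j). q (f x) j)"
  note dimA = carrier_matD[OF A]
  have PQ: "(P * Q) $$ (i, j) = (\<Sum>u\<in>U. p i u * q u j)" if "i < n" "j < n" for i j
  proof -
    have "(P * Q) $$ (i, j) = (\<Sum>x<card U. p i (f x) * q (f x) j)"
      using that by (auto simp: P_def Q_def scalar_prod_def atLeast0LessThan intro!: sum.cong)
    also have "\<dots> = (\<Sum>u\<in>U. p i u * q u j)" by (rule sum.reindex_bij_betw[OF f])
    finally show ?thesis .
  qed
  have "A ^\<^sub>m t = P * Q"
  proof (rule eq_matI)
    fix i j assume "i < dim_row (P * Q)" "j < dim_col (P * Q)"
    then have ij: "i < n" "j < n" by (auto simp: P_def Q_def)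
    have "(A ^\<^sub>m t) $$ (i, j) \<le> (\<Sum>u\<in>U. p i u * q u j)"
    proof (cases "(A ^\<^sub>m t) $$ (i, j) = NegInf")
      case False
      then obtain xs where xs: "walk {..<n} xs j" "src xs j = i" "length xs = t"
        "(A ^\<^sub>m t) $$ (i, j) = Fin (wt xs j)"
        using pow_walk[of i j "{..<n}" t] ij unfolding induced_all by auto
      have "\<not> walk {} xs j" using walk_end by blast
      then obtain v w where v: "v \<in> U" "wt xs j \<le> w" "via (D v) (Cy v) i j t w"
        using sel xs(1-3) unfolding selection_def by metis
      from via_aligned[OF U(4)[OF v(1)] v(3)] obtain u ys zs where
        u: "u \<in> Cy v" "walk (D v) ys u" "src ys u = i" "length ys = Suc t * card (Cy v)"
        "walk (D v) zs j" "src zs j = u" "length zs = Suc t * card (Cy v) + t"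
        "wt ys u + wt zs j = w + 2 * \<mu> v * (Suc t * card (Cy v))" by blast
      have uU: "u \<in> U" using U(2)[OF v(1)] u(1) by blast
      \<comment> \<open>The cut \<open>u\<close> may differ from the vertex \<open>v\<close> naming
        the class, but both lie on the same cycle and share its data.\<close>
      have D: "D v = D u" "Cy v = Cy u" "\<mu> v = \<mu> u" using U(5)[OF v(1) u(1)] by auto
      note u' = u(2-8)[unfolded D, folded N_def]
      have N: "Suc t * card (Cy u) = N u" unfolding N_def ..
      have "(A ^\<^sub>m t) $$ (i, j) \<le> Fin w" using xs(4) v(2) by simp
      also have "\<dots> = (Fin (wt ys u) * Fin (- (\<mu> u * N u))) * (Fin (wt zs j) * Fin (- (\<mu> u * N u)))"
        using u(8) unfolding D N by simp
      also have "\<dots> \<le> p i u * q u j"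
        unfolding p_def q_def
        using walk_le_pow[OF U(3)[OF uU] u(2)[unfolded D]] walk_le_pow[OF U(3)[OF uU] u(5)[unfolded D]]
        unfolding u(3,4,6,7) D N by (intro trop_mult_mono) auto
      also have "\<dots> \<le> (\<Sum>u\<in>U. p i u * q u j)" using trop_le_sum[OF finU uU] .
      finally show ?thesis .
    qed simp
    \<comment> \<open>Conversely, finite factors come from a walk of length
      \<open>2 * N u + t\<close> through the cycle of \<open>u\<close>. As \<open>N u\<close> is a
      multiple of the cycle length, \<open>via_exact_length\<close> brings it back to length
      \<open>t\<close> with weight at least the normalized product.\<close>
    moreover have "(\<Sum>u\<in>U. p i u * q u j) \<le> (A ^\<^sub>m t) $$ (i, j)"
    proof (rule trop_sum_le[OF finU])
      fix u assume u: "u \<in> U"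
      have uD: "u \<in> D u" "u < n" using U(1,4)[OF u] UN u unfolding critical_def by auto
      show "p i u * q u j \<le> (A ^\<^sub>m t) $$ (i, j)"
      proof (cases "p i u * q u j = NegInf")
        case False
        then have ne: "(induced (D u) ^\<^sub>m N u) $$ (i, u) \<noteq> NegInf"
          "(induced (D u) ^\<^sub>m (N u + t)) $$ (u, j) \<noteq> NegInf"
          unfolding p_def q_def by auto
        obtain ys where ys: "walk (D u) ys u" "src ys u = i" "length ys = N u"
          "(induced (D u) ^\<^sub>m N u) $$ (i, u) = Fin (wt ys u)"
          using pow_walk[OF ij(1) uD(2) _ ne(1)] uD(1) by blast
        obtain zs where zs: "walk (D u) zs j" "src zs j = u" "length zs = N u + t"
          "(induced (D u) ^\<^sub>m (N u + t)) $$ (u, j) = Fin (wt zs j)"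
          using pow_walk[OF uD(2) ij(2) _ ne(2)] uD(1) by blast
        let ?d = "card (Cy u)" and ?w = "wt ys u + wt zs j"
        have via: "via (D u) (Cy u) i j (N u + (N u + t)) ?w"
          unfolding via_def using ys zs U(1)[OF u] by metis
        have fin: "finite (D u)" and cD: "card (D u) \<le> n"
          using U(3)[OF u] finite_subset card_mono[of "{..<n}" "D u"] by auto
        have "?d * card (D u) + card (D u) \<le> t + 2 * ?d"
        proof (rule level_length_bound[OF _ cD _ _ t])
          show "?d \<le> card (D u)" using card_mono[OF fin] U(4)[OF u] unfolding critical_def by blast
          show "?d < n" using card_mono[OF finU U(2)[OF u]] small by simp
          show "0 < ?d" using critical_card_pos[OF U(4)[OF u]] .
        qed
        moreover have "(N u + (N u + t)) mod ?d = t mod ?d" unfolding N_def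
          by (metis mod_mult_self3 mult.commute)
        ultimately obtain w where w: "via (D u) (Cy u) i j t w"
          "?w + \<mu> u * (real t - real (N u + (N u + t))) \<le> w"
          using via_exact_length[OF fin U(4)[OF u] via] by blast
        obtain as bs k where ab: "walk (D u) as k" "src as k = i" "walk (D u) bs j" "src bs j = k"
          "t = length as + length bs" "w = wt as k + wt bs j" using w(1) unfolding via_def by blast
        have "walk {..<n} (as @ bs) j" using ab walk_mono[OF _ U(3)[OF u]] by auto
        from walk_le_pow[OF _ this] have "Fin w \<le> (A ^\<^sub>m t) $$ (i, j)"
          using ab unfolding induced_all by simp
        moreover have "p i u * q u j \<le> Fin w"
          unfolding p_def q_def ys(4) zs(4) using w(2) by (simp add: algebra_simps)
        ultimately show ?thesis by (rule order_trans[rotated])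
      next
        case True
        then show ?thesis by (simp only: less_eq_trop.simps)
      qed
    qed
    ultimately show "(A ^\<^sub>m t) $$ (i, j) = (P * Q) $$ (i, j)" unfolding PQ[OF ij] by (rule antisym)
  qed (auto simp: P_def Q_def dimA)
  then show ?thesis by (intro factor_rank_le) (auto simp: P_def Q_def dimA)
qed

end

theorem theorem2p20:
  fixes A :: "trop mat" and n t :: nat
  assumes "n \<ge> 1"
    and "A \<in> carrier_mat n n"
    and "t \<ge> (n - 1)\<^sup>2 + 1"
  shows "factor_rank (A ^\<^sub>m t) \<le> tropical_rank A"
proof -
  interpret trop_matrix A n by unfold_locales fact
  obtain U D Cy \<pi> \<mu> where sel: "selection {..<n} t {} U D Cy \<pi> \<mu>"
    by (rule selection_complete[of "{..<n}" t]) (use assms(1,3) in auto)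
  have rank: "card U \<le> tropical_rank A"
    using sel unfolding selection_def by (intro card_le_tropical_rank) blast+
  show ?thesis
  proof (cases "card U < n")
    case True
    then show ?thesis using factor_rank_pow_le_selection[OF sel True assms(3)] rank by simp
  next
    \<comment> \<open>Now \<open>n \<le> card U\<close>, which is at most the tropical rank, and
      factoring off the identity matrix suffices.\<close>
    case False
    have "A ^\<^sub>m t \<in> carrier_mat n n" using assms(2) by (rule pow_carrier_mat)
    then have "factor_rank (A ^\<^sub>m t) \<le> n"
      by (intro factor_rank_le[of "A ^\<^sub>m t" _ _ "1\<^sub>m n"]) auto
    then show ?thesis using False rank by simp
  qed
qed

end
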